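(* Let $K\subset\mathbb{R}^2$ be a strictly convex domain whose boundary $\partial K$ is an oval, with area $A_{\partial K}$ and perimeter $L_{\partial K}$, and let $\widetilde{A}_{E_{1/2}(\partial K)}$ denote the oriented area of the Wigner caustic of $\partial K$. Let $W_K$ denote the convex body for which $\partial W_K$ is the Wigner caustic type curve associated with $\partial K$. Then $$L_{\partial K}^2-4\pi A_{\partial K}-8\pi\left|\widetilde{A}_{E_{1/2}(\partial K)}\right|\geqslant 4\pi^2\, d_\infty^2(K,W_K),$$ where equality holds if and only if $\partial K$ is a curve of constant width.
   Context: An oval is a smooth ($C^\infty$) regular closed simple curve in $\mathbb{R}^2$ that is convex, i.e. its signed curvature has constant sign (in particular it is nowhere zero). Let $M=\partial K$. Fix an origin $O$ inside $M$ and orient $M$ positively. For $\theta\in\mathbb{R}$ let $p_M(\theta)$ be the Minkowski support function of $M$: the oriented distance from $O$ to the tangent line of $M$ whose outer normal is $(\cos\theta,\sin\theta)$. It is $2\pi$-periodic, and $M$ is parametrized by $\gamma(\theta)=\big(p_M(\theta)\cos\theta-p_M'(\theta)\sin\theta,\ p_M(\theta)\sin\theta+p_M'(\theta)\cos\theta\big)$, with radius of curvature $p_M+p_M''>0$. A parallel pair of $M$ is a pair of distinct points $a,b\in M$ at which the tangent lines are parallel. The Wigner caustic is $E_{1/2}(M)=\{\tfrac12 a+\tfrac12 b: a,b\text{ a parallel pair of }M\}$, parametrized by $\gamma_{1/2}(\theta)=\tfrac12\gamma(\theta)+\tfrac12\gamma(\theta+\pi)$, $\theta\in[0,\pi]$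 (one traversal). Its oriented area is $\widetilde{A}_{E_{1/2}(M)}=\frac12\int_0^\pi(\gamma_{1/2,1}\gamma_{1/2,2}'-\gamma_{1/2,2}\gamma_{1/2,1}')\,d\theta$. The Wigner caustic type curve associated with $M$ is the curve $W_M$ with support function $$p_{W_M}(\theta)=\frac{L_M}{2\pi}+\frac{p_M(\theta)-p_M(\theta+\pi)}{2},$$ where $L_M$ is the length of $M$. So $p_{\partial W_K}=p_{W_{\partial K}}$, and $W_K$ enters the claim only through this function. For $K,N$ with support functions $p_{\partial K},p_{\partial N}$, the Hausdorff distance is $d_\infty(K,N)=\max_\theta|p_{\partial K}(\theta)-p_{\partial N}(\theta)|$. An oval has constant width if the distance between every pair of (distinct) parallel tangent lines is the same, i.e. $p_M(\theta)+p_M(\theta+\pi)$ is constant. *)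

theory Defs
  imports "HOL-Analysis.Analysis"
begin

abbreviation velocity :: "(real \<Rightarrow> real^2) \<Rightarrow> real \<Rightarrow> real^2" where
  "velocity \<gamma> t \<equiv> vector_derivative \<gamma> (at t)"

definition cross2 :: "real^2 \<Rightarrow> real^2 \<Rightarrow> real" where
  "cross2 v w = v $ 1 * w $ 2 - v $ 2 * w $ 1"

definition smooth_curve :: "(real \<Rightarrow> real^2) \<Rightarrow> bool" where
  "smooth_curve \<gamma> \<longleftrightarrow> (\<forall>n t. (velocity ^^ n) \<gamma> differentiable (at t))"

definition signed_curvature :: "(real \<Rightarrow> real^2) \<Rightarrow> real \<Rightarrow> real" where
  "signed_curvature \<gamma> t =
     cross2 (velocity \<gamma> t) (velocity (velocity \<gamma>) t) / norm (velocity \<gamma> t) ^ 3"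

text \<open>
  A closed curve is given by a 1-periodic map on the whole line, so that smoothness also holds
  where the curve closes up; one traversal is the restriction to the unit interval, to which the
  library notions \<^const>\<open>simple_path\<close> and \<^const>\<open>path_image\<close> refer.
  Either orientation is allowed.
\<close>

definition oval :: "(real \<Rightarrow> real^2) \<Rightarrow> bool" where
  "oval \<gamma> \<longleftrightarrow>
     smooth_curve \<gamma> \<and>
     (\<forall>t. \<gamma> (t + 1) = \<gamma> t) \<and>
     (\<forall>t. velocity \<gamma> t \<noteq> 0) \<and>
     simple_path \<gamma> \<and>
     ((\<forall>t. signed_curvature \<gamma> t > 0) \<or> (\<forall>t. signed_curvature \<gamma> t < 0))"

definition curve_length :: "(real \<Rightarrow> real^2) \<Rightarrow> real" where
  "curve_length \<gamma> = integral {0..1} (\<lambda>t. norm (velocity \<gamma> t))"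

definition strictly_convex :: "(real^2) set \<Rightarrow> bool" where
  "strictly_convex K \<longleftrightarrow>
     convex K \<and> (\<forall>x\<in>K. \<forall>y\<in>K. x \<noteq> y \<longrightarrow> open_segment x y \<subseteq> interior K)"

definition tangent_line :: "(real \<Rightarrow> real^2) \<Rightarrow> real \<Rightarrow> (real^2) set" where
  "tangent_line \<gamma> t = {\<gamma> t + s *\<^sub>R velocity \<gamma> t | s. True}"

definition constant_width :: "(real \<Rightarrow> real^2) \<Rightarrow> bool" where
  "constant_width \<gamma> \<longleftrightarrow>
     (\<exists>w. \<forall>s t. cross2 (velocity \<gamma> s) (velocity \<gamma> t) = 0 \<and> tangent_line \<gamma> s \<noteq> tangent_line \<gamma> t
        \<longrightarrow> setdist (tangent_line \<gamma> s) (tangent_line \<gamma> t) = w)"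

definition unit_vec :: "real \<Rightarrow> real^2" where
  "unit_vec \<theta> = vector [cos \<theta>, sin \<theta>]"

text \<open>The tangent line at parameter \<open>t\<close> of the boundary of \<open>K\<close> has outer normal \<open>u\<close>.\<close>

definition outer_normal :: "(real^2) set \<Rightarrow> (real \<Rightarrow> real^2) \<Rightarrow> real \<Rightarrow> real^2 \<Rightarrow> bool" where
  "outer_normal K \<gamma> t u \<longleftrightarrow>
     norm u = 1 \<and> velocity \<gamma> t \<bullet> u = 0 \<and> (\<forall>x\<in>K. (x - \<gamma> t) \<bullet> u \<le> 0)"

text \<open>
  The Minkowski support function with respect to the origin \<open>q\<close>: the oriented distance from
  \<open>q\<close> to the tangent line with outer normal \<open>unit_vec \<theta>\<close>. If \<open>K\<close> is compact and \<open>\<gamma>\<close>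
  parametrizes its boundary, there is at most one such value, since it is the maximum over
  \<open>x \<in> K\<close> of \<open>(x - q) \<bullet> unit_vec \<theta>\<close>.
\<close>

definition support_fun :: "(real^2) set \<Rightarrow> (real \<Rightarrow> real^2) \<Rightarrow> real^2 \<Rightarrow> real \<Rightarrow> real" where
  "support_fun K \<gamma> q \<theta> =
     (THE h. \<exists>t. outer_normal K \<gamma> t (unit_vec \<theta>) \<and> h = (\<gamma> t - q) \<bullet> unit_vec \<theta>)"

text \<open>The parametrization by the angle of the outer normal of the curve with support function
  \<open>p\<close> with respect to the origin \<open>q\<close>.\<close>

definition support_param :: "(real \<Rightarrow> real) \<Rightarrow> real^2 \<Rightarrow> real \<Rightarrow> real^2" where
  "support_param p q \<theta> =
     q + vector [p \<theta> * cos \<theta> - deriv p \<theta> * sin \<theta>, p \<theta> * sin \<theta> + deriv p \<theta> * cos \<theta>]"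

definition wigner_param :: "(real \<Rightarrow> real) \<Rightarrow> real^2 \<Rightarrow> real \<Rightarrow> real^2" where
  "wigner_param p q \<theta> =
     (1/2) *\<^sub>R support_param p q \<theta> + (1/2) *\<^sub>R support_param p q (\<theta> + pi)"

text \<open>One traversal of the Wigner caustic is \<open>0 \<le> \<theta> \<le> pi\<close>; the full period would count the
  area twice.\<close>

definition wigner_area :: "(real \<Rightarrow> real) \<Rightarrow> real^2 \<Rightarrow> real" where
  "wigner_area p q =
     (1/2) * integral {0..pi} (\<lambda>\<theta>. cross2 (wigner_param p q \<theta>) (velocity (wigner_param p q) \<theta>))"

text \<open>The support function of the Wigner caustic type curve of a curve of length \<open>L\<close> with
  support function \<open>p\<close>.\<close>

definition wigner_type_support :: "real \<Rightarrow> (real \<Rightarrow> real) \<Rightarrow> real \<Rightarrow> real" where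
  "wigner_type_support L p \<theta> = L / (2 * pi) + (p \<theta> - p (\<theta> + pi)) / 2"

text \<open>The Hausdorff distance expressed by support functions; for continuous periodic functions
  the supremum is attained.\<close>

definition d_infty :: "(real \<Rightarrow> real) \<Rightarrow> (real \<Rightarrow> real) \<Rightarrow> real" where
  "d_infty p r = (SUP \<theta>. \<bar>p \<theta> - r \<theta>\<bar>)"

end

theory Submission
  imports Defs
begin

text \<open>
  Write \<open>p\<close> for the support function of the curve, \<open>h(x) = (p(x) + p(x + pi)) / 2\<close> and
  \<open>e(x) = (p(x) - p(x + pi)) / 2\<close> for its parts that are even and odd under the half turn, and
  \<open>W\<close> for the oriented area of the Wigner caustic, which is the curve with support function \<open>e\<close>.
  All integrals below run over \<open>[0, pi]\<close>. Since \<open>L = 2 \<integral> h\<close>, \<open>2 W = \<integral> (e\<^sup>2 - e'\<^sup>2)\<close> and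
  \<open>A = \<integral> (h\<^sup>2 - h'\<^sup>2) + \<integral> (e\<^sup>2 - e'\<^sup>2)\<close>, and since \<open>W \<le> 0\<close> by Wirtinger's inequality, the term
  \<open>8 pi |W|\<close> removes exactly what the odd part contributes to the isoperimetric deficit. With
  \<open>s = h - L / (2 pi)\<close>, which is \<open>pi\<close>-periodic and has mean zero, what remains is
  \<open>4 pi \<integral> (s'\<^sup>2 - s\<^sup>2)\<close>. On the other side, \<open>s\<close> is precisely the difference of the two support
  functions whose distance is measured. The theorem is therefore the estimate
  \<open>pi max s\<^sup>2 \<le> \<integral> (s'\<^sup>2 - s\<^sup>2)\<close>, with equality only for \<open>s = 0\<close>, that is, for constant width
  (\<open>sup_bound_mean_zero_periodic\<close>).

  To see it, let \<open>|s|\<close> be maximal at \<open>a\<close> and put \<open>u = s - s(a)\<close>. As \<open>s\<close> has mean zero,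
  \<open>\<integral> (s'\<^sup>2 - s\<^sup>2) = \<integral> (u'\<^sup>2 - u\<^sup>2) + pi s(a)\<^sup>2\<close>, and \<open>u\<close> vanishes at both ends of
  \<open>[a, a + pi]\<close>, so the first integral on the right is nonnegative (\<open>dirichlet_poincare\<close>). It is
  zero only for \<open>u(x) = c sin (x - a)\<close>; this function has slopes \<open>c\<close> and \<open>- c\<close> at the two ends,
  whereas \<open>u'\<close> is \<open>pi\<close>-periodic, so \<open>c = 0\<close>, and \<open>s\<close> is constant and hence zero.

  The geometric part expresses length, area, Wigner area and width by \<open>p\<close>. The angle of the outer
  normal is a strictly monotone function of the curve parameter that grows by exactly one full turn
  per traversal, because a strictly convex body has only one point with a given outer normal
  (\<open>\<phi>_period\<close>). Reparametrizing by this angle gives a curve \<open>X\<close> with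
  \<open>X'(x) = \<rho>(x) (- sin x, cos x)\<close> and \<open>\<rho> = p + p''\<close>. Then \<open>L = \<integral> \<rho>\<close> over a full turn, and the cone map
  \<open>(r, x) \<mapsto> q + r (X(x) - q)\<close>, whose Jacobian is \<open>r p \<rho>\<close>, yields the area
  (\<open>area\<close> in the locale \<open>normal_parametrization\<close>).
\<close>

section \<open>Periodic functions and a Poincare inequality\<close>

lemma antiderivative_on_line:
  fixes f :: "real \<Rightarrow> real"
  assumes "continuous_on UNIV f"
  obtains F where "\<And>x. (F has_real_derivative f x) (at x)"
proof -
  have "isCont f x" for x
    using assms by (simp add: continuous_on_eq_continuous_at)
  then obtain F where "\<forall>x::real. -\<infinity> < ereal x \<longrightarrow> ereal x < \<infinity> \<longrightarrow> (F has_vector_derivative f x) (at x)"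
    using einterval_antiderivative[of "-\<infinity>" "\<infinity>" f] by auto
  then have "\<And>x. (F has_real_derivative f x) (at x)"
    by (simp add: has_real_derivative_iff_has_vector_derivative)
  then show thesis by (rule that)
qed

lemma integral_of_derivative:
  fixes F f :: "real \<Rightarrow> real"
  assumes "\<And>x. (F has_real_derivative f x) (at x)" "a \<le> b"
  shows "(f has_integral F b - F a) {a..b}"
  using assms
  by (intro fundamental_theorem_of_calculus)
     (auto simp: has_real_derivative_iff_has_vector_derivative[symmetric] intro: DERIV_subset)

lemma constant_difference_of_periodic_derivative:
  fixes F f :: "real \<Rightarrow> real"
  assumes F: "\<And>x. (F has_real_derivative f x) (at x)" and "\<And>x. f (x + T) = f x"
  shows "F (x + T) - F x = F (y + T) - F y"
proof -
  have "((\<lambda>x. F (x + T) - F x) has_real_derivative f (x + T) - f x) (at x)" for x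
    using F[of "x + T"] F[of x] by (intro DERIV_diff) (simp_all add: DERIV_shift)
  then have "\<forall>x. ((\<lambda>x. F (x + T) - F x) has_real_derivative 0) (at x)"
    by (simp add: assms(2))
  then show ?thesis by (rule DERIV_isconst_all)
qed

lemma integral_periodic_shift:
  fixes f :: "real \<Rightarrow> real"
  assumes "continuous_on UNIV f" "\<And>x. f (x + T) = f x" "0 \<le> T"
  shows "integral {a..a + T} f = integral {b..b + T} f"
proof -
  obtain F where F: "\<And>x. (F has_real_derivative f x) (at x)"
    using antiderivative_on_line[OF assms(1)] by blast
  show ?thesis
    using integral_of_derivative[OF F, of a "a + T"] integral_of_derivative[OF F, of b "b + T"]
      constant_difference_of_periodic_derivative[of F f T, OF F assms(2), of a b] assms(3)
    by (simp add: integral_unique)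
qed

text \<open>
  At a zero of the sine, \<open>cot\<close> has a simple pole and \<open>u\<^sup>2\<close> a double zero. This makes the boundary
  terms vanish in the completion of the square below.
\<close>

lemma square_times_cot_tendsto_0:
  fixes u :: "real \<Rightarrow> real"
  assumes "(u has_real_derivative d) (at z)" "u z = 0" "sin z = 0"
  shows "((\<lambda>x. u x ^ 2 * cot x) \<longlongrightarrow> 0) (at z)"
proof -
  have nz: "cos z \<noteq> 0"
    using assms(3) sin_cos_squared_add[of z] by auto
  have 1: "((\<lambda>x. u x / (x - z)) \<longlongrightarrow> d) (at z)"
    using assms(1,2) by (simp add: has_field_derivative_iff)
  have 2: "((\<lambda>x. sin x / (x - z)) \<longlongrightarrow> cos z) (at z)"
    using DERIV_sin[of z] assms(3) by (simp add: has_field_derivative_iff)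
  have "((\<lambda>x. (u x / (x - z))^2 * (x - z) * (cos x / (sin x / (x - z)))) \<longlongrightarrow> d^2 * (z - z) * (cos z / cos z)) (at z)"
    by (intro tendsto_intros 1 2 nz)
  moreover have "\<forall>\<^sub>F x in at z. (u x / (x - z))^2 * (x - z) * (cos x / (sin x / (x - z))) = u x ^ 2 * cot x"
    unfolding eventually_at_filter
    by (intro always_eventually) (auto simp: cot_def power2_eq_square)
  ultimately show ?thesis
    using tendsto_cong by fastforce
qed

text \<open>
  On the open interval \<open>u'\<^sup>2 - u\<^sup>2 = (u' - u cot)\<^sup>2 + (u\<^sup>2 cot)'\<close>, and \<open>u\<^sup>2 cot\<close> tends to zero at
  both ends. Hence the integral is that of a square, and it vanishes only if \<open>u' = u cot\<close>, that is,
  if \<open>u / sin\<close> is constant.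
\<close>

lemma dirichlet_poincare:
  fixes u u' :: "real \<Rightarrow> real"
  assumes u: "\<And>x. (u has_real_derivative u' x) (at x)" and cont: "continuous_on UNIV u'"
    and "u 0 = 0" "u pi = 0"
  shows "integral {0..pi} (\<lambda>x. u' x ^ 2 - u x ^ 2) \<ge> 0"
    and "integral {0..pi} (\<lambda>x. u' x ^ 2 - u x ^ 2) = 0 \<Longrightarrow> \<exists>c. \<forall>x\<in>{0<..<pi}. u x = c * sin x"
proof -
  define I where "I = integral {0..pi} (\<lambda>x. u' x ^ 2 - u x ^ 2)"
  define G where "G x = u x ^ 2 * cot x" for x
  define R where "R x = u' x - u x * cot x" for x
  have contu: "continuous_on A u" for A
    using u by (meson DERIV_isCont continuous_at_imp_continuous_on)
  have cont': "continuous_on A u'" for A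
    using cont continuous_on_subset by blast
  have sp: "sin x > 0" if "0 < x" "x < pi" for x
    using that by (rule sin_gt_zero)
  have dG: "(G has_real_derivative (u' x ^ 2 - u x ^ 2 - R x ^ 2)) (at x)" if "0 < x" "x < pi" for x
  proof -
    have nz: "sin x \<noteq> 0" using sp[OF that] by simp
    have "(G has_real_derivative (2 * u x * u' x * cot x + u x ^ 2 * (- inverse (sin x ^ 2)))) (at x)"
      unfolding G_def
      by (rule derivative_eq_intros u DERIV_cot nz refl | simp)+
    moreover have "2 * u x * u' x * cot x + u x ^ 2 * (- inverse (sin x ^ 2)) = u' x ^ 2 - u x ^ 2 - R x ^ 2"
    proof -
      have "cot x ^ 2 = inverse (sin x ^ 2) - 1"
        using nz sin_cos_squared_add2[of x] by (simp add: cot_def power_divide field_simps)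
      then have "u x ^ 2 * cot x ^ 2 = u x ^ 2 * inverse (sin x ^ 2) - u x ^ 2"
        by (simp only: right_diff_distrib mult_1_right)
      then have "R x ^ 2 = u' x ^ 2 - 2 * u x * u' x * cot x + (u x ^ 2 * inverse (sin x ^ 2) - u x ^ 2)"
        unfolding R_def by (simp add: power2_diff power_mult_distrib algebra_simps)
      then show ?thesis by simp
    qed
    ultimately show ?thesis by simp
  qed
  \<comment> \<open>At the ends \<open>cot\<close> only has a default value, but the factor \<open>u x ^ 2\<close> is zero there.\<close>
  have G0: "G 0 = 0" "G pi = 0" by (simp_all add: G_def assms)
  have "isCont G x" if "x \<in> {0..pi}" for x
  proof (cases "0 < x \<and> x < pi")
    case True
    then show ?thesis using dG DERIV_isCont by blast
  next
    case False
    then have "x = 0 \<or> x = pi" using that by auto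
    then have "sin x = 0" "u x = 0" "G x = 0" using assms G0 by auto
    then show ?thesis
      using square_times_cot_tendsto_0[OF u, of x] by (simp add: isCont_def G_def[abs_def])
  qed
  then have contG: "continuous_on {0..pi} G"
    by (simp add: continuous_at_imp_continuous_on)
  have "((\<lambda>x. u' x ^ 2 - u x ^ 2 - R x ^ 2) has_integral G pi - G 0) {0..pi}"
    by (rule fundamental_theorem_of_calculus_interior[OF _ contG])
       (use dG in \<open>auto simp: has_real_derivative_iff_has_vector_derivative[symmetric]\<close>)
  moreover have "((\<lambda>x. u' x ^ 2 - u x ^ 2) has_integral I) {0..pi}"
    unfolding I_def
    by (intro integrable_integral integrable_continuous_real continuous_intros contu cont')
  ultimately have "((\<lambda>x. (u' x ^ 2 - u x ^ 2) - (u' x ^ 2 - u x ^ 2 - R x ^ 2)) has_integral (I - (G pi - G 0))) {0..pi}"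
    by (rule has_integral_diff[rotated])
  then have R: "((\<lambda>x. R x ^ 2) has_integral I) {0..pi}"
    using G0 by simp
  then show "integral {0..pi} (\<lambda>x. u' x ^ 2 - u x ^ 2) \<ge> 0"
    using has_integral_nonneg[OF R] I_def by simp
  assume "integral {0..pi} (\<lambda>x. u' x ^ 2 - u x ^ 2) = 0"
  then have R0: "((\<lambda>x. R x ^ 2) has_integral 0) {0..pi}"
    using R I_def by simp
  have Rz: "R x = 0" if x: "0 < x" "x < pi" for x
  proof -
    \<comment> \<open>\<open>R\<close> is only known to be continuous inside, so its square is shown to vanish on a compact subinterval around \<open>x\<close>.\<close>
    define a b where "a = x / 2" and "b = (x + pi) / 2"
    have ab: "0 < a" "a < x" "x < b" "b < pi" using x by (auto simp: a_def b_def)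
    have nz: "sin y \<noteq> 0" if "y \<in> {a..b}" for y
      using sp[of y] that ab by auto
    have cR: "continuous_on {a..b} (\<lambda>x. R x ^ 2)"
      unfolding R_def cot_def by (intro continuous_intros contu cont') (use nz in auto)
    then obtain J where J: "((\<lambda>x. R x ^ 2) has_integral J) {a..b}"
      using integrable_continuous_real by blast
    have "J \<le> 0"
      by (rule has_integral_subset_le[OF _ J R0]) (use ab in auto)
    moreover have "J \<ge> 0" by (rule has_integral_nonneg[OF J]) simp
    ultimately have "((\<lambda>x. R x ^ 2) has_integral 0) (cbox a b)" using J by simp
    from has_integral_0_cbox_imp_0[OF _ _ this, of x] cR ab
    show ?thesis by (auto simp: box_real)
  qed
  have "\<exists>c. \<forall>x\<in>{0<..<pi}. u x / sin x = c"
  proof (rule has_field_derivative_zero_constant)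
    fix x :: real assume "x \<in> {0<..<pi}"
    then have nz: "sin x \<noteq> 0" and x: "0 < x" "x < pi" using sp[of x] by auto
    have "((\<lambda>x. u x / sin x) has_real_derivative (u' x * sin x - u x * cos x) / (sin x * sin x)) (at x)"
      by (rule derivative_eq_intros u nz refl | simp)+
    moreover have "u' x * sin x - u x * cos x = 0"
      using Rz[OF x] nz by (simp add: R_def cot_def field_simps)
    ultimately show "((\<lambda>x. u x / sin x) has_real_derivative 0) (at x within {0<..<pi})"
      by (simp add: has_field_derivative_at_within)
  qed simp
  then obtain c where c: "\<forall>x\<in>{0<..<pi}. u x / sin x = c" by blast
  have "u x = c * sin x" if "x \<in> {0<..<pi}" for x
    using c[rule_format, OF that] sp[of x] that by (auto simp: field_simps)
  then show "\<exists>c. \<forall>x\<in>{0<..<pi}. u x = c * sin x" by blast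
qed

text \<open>
  Only the squares are assumed periodic, so that the lemma applies both to \<open>pi\<close>-periodic functions
  and to those that change sign under a shift by \<open>pi\<close>. In the equality case the slopes of
  \<open>c sin (x - a)\<close> at the two ends are opposite, which contradicts equal slopes unless \<open>c = 0\<close>.
\<close>

lemma dirichlet_poincare_periodic:
  fixes u u' :: "real \<Rightarrow> real"
  assumes u: "\<And>x. (u has_real_derivative u' x) (at x)" and cont: "continuous_on UNIV u'"
    and sq: "\<And>x. u (x + pi) ^ 2 = u x ^ 2" "\<And>x. u' (x + pi) ^ 2 = u' x ^ 2" and "u a = 0"
  shows "integral {0..pi} (\<lambda>x. u' x ^ 2 - u x ^ 2) \<ge> 0"
    and "integral {0..pi} (\<lambda>x. u' x ^ 2 - u x ^ 2) = 0 \<Longrightarrow> u' (a + pi) = u' a \<Longrightarrow> \<forall>x\<in>{a<..<a + pi}. u x = 0"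
proof -
  have contu: "continuous_on A u" for A
    using u by (meson DERIV_isCont continuous_at_imp_continuous_on)
  have d: "((\<lambda>x. u (a + x)) has_real_derivative u' (a + x)) (at x)" for x
    using u[of "a + x"] DERIV_shift[of u "u' (a + x)" x a] by (simp add: add.commute)
  have c: "continuous_on UNIV (\<lambda>x. u' (a + x))"
    by (rule continuous_on_compose2[OF cont]) (auto intro: continuous_intros)
  have z: "u (a + 0) = 0" "u (a + pi) = 0" using assms(5) sq(1)[of a] by auto
  have "integral {0..pi} (\<lambda>x. u' x ^ 2 - u x ^ 2) = integral {a..a + pi} (\<lambda>x. u' x ^ 2 - u x ^ 2)"
    using integral_periodic_shift[of "\<lambda>x. u' x ^ 2 - u x ^ 2" pi 0 a]
    by (simp add: sq continuous_intros contu cont)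
  also have "\<dots> = integral {0..pi} (\<lambda>x. u' (a + x) ^ 2 - u (a + x) ^ 2)"
    using integral_shift_Icc_real[of 0 pi "\<lambda>x. u' x ^ 2 - u x ^ 2" a] by (simp add: o_def add.commute)
  finally have eq: "integral {0..pi} (\<lambda>x. u' x ^ 2 - u x ^ 2) = \<dots>" .
  show "integral {0..pi} (\<lambda>x. u' x ^ 2 - u x ^ 2) \<ge> 0"
    unfolding eq by (rule dirichlet_poincare[OF d c z])
  assume "integral {0..pi} (\<lambda>x. u' x ^ 2 - u x ^ 2) = 0" and per: "u' (a + pi) = u' a"
  then obtain k where k: "\<forall>x\<in>{0<..<pi}. u (a + x) = k * sin x"
    using dirichlet_poincare(2)[OF d c z] eq by auto
  then have k': "\<forall>x\<in>{0..pi}. u (a + x) = k * sin x"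
    using z by (metis add.right_neutral atLeastAtMost_iff greaterThanLessThan_iff less_eq_real_def mult_zero_right sin_pi sin_zero)
  have at0: "u' (a + 0) = k * cos 0"
  proof (rule vector_derivative_unique_within)
    show "at (0::real) within {0..pi} \<noteq> bot"
      by (simp add: trivial_limit_within)
    show "((\<lambda>x. u (a + x)) has_vector_derivative u' (a + 0)) (at 0 within {0..pi})"
      using d[of 0] by (auto simp: has_real_derivative_iff_has_vector_derivative intro: has_vector_derivative_at_within)
    have "((\<lambda>x. k * sin x) has_vector_derivative k * cos 0) (at 0 within {0..pi})"
      unfolding has_real_derivative_iff_has_vector_derivative[symmetric]
      by (rule derivative_eq_intros refl | simp)+
    then show "((\<lambda>x. u (a + x)) has_vector_derivative k * cos 0) (at 0 within {0..pi})"
      by (rule has_vector_derivative_transform[rotated 2]) (use k' in auto)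
  qed
  have atpi: "u' (a + pi) = k * cos pi"
  proof (rule vector_derivative_unique_within)
    show "at pi within {0..pi} \<noteq> bot"
      by (simp add: trivial_limit_within)
    show "((\<lambda>x. u (a + x)) has_vector_derivative u' (a + pi)) (at pi within {0..pi})"
      using d[of pi] by (auto simp: has_real_derivative_iff_has_vector_derivative intro: has_vector_derivative_at_within)
    have "((\<lambda>x. k * sin x) has_vector_derivative k * cos pi) (at pi within {0..pi})"
      unfolding has_real_derivative_iff_has_vector_derivative[symmetric]
      by (rule derivative_eq_intros refl | simp)+
    then show "((\<lambda>x. u (a + x)) has_vector_derivative k * cos pi) (at pi within {0..pi})"
      by (rule has_vector_derivative_transform[rotated 2]) (use k' in auto)
  qed
  have "k = 0" using at0 atpi per by simp
  show "\<forall>x\<in>{a<..<a + pi}. u x = 0"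
  proof
    fix x assume "x \<in> {a<..<a + pi}"
    then show "u x = 0" using k[rule_format, of "x - a"] \<open>k = 0\<close> by auto
  qed
qed

text \<open>
  Subtracting the constant \<open>s a\<close> produces a function that vanishes at \<open>a\<close> and \<open>a + pi\<close>, and because
  of the zero mean it changes the integral by exactly \<open>pi * (s a)\<^sup>2\<close>. The constant is sharp among
  Lipschitz functions: there \<open>1 - (pi / 2) * \<bar>sin x\<bar>\<close> attains equality at \<open>a = 0\<close>, and its corner is what
  differentiability excludes.
\<close>

lemma sup_bound_mean_zero_periodic:
  fixes s s' :: "real \<Rightarrow> real"
  assumes s: "\<And>x. (s has_real_derivative s' x) (at x)" and cont: "continuous_on UNIV s'"
    and per: "\<And>x. s (x + pi) = s x" "\<And>x. s' (x + pi) = s' x" and mean: "integral {0..pi} s = 0"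
  shows "pi * (s a)\<^sup>2 \<le> integral {0..pi} (\<lambda>x. s' x ^ 2 - s x ^ 2)"
    and "integral {0..pi} (\<lambda>x. s' x ^ 2 - s x ^ 2) = pi * (s a)\<^sup>2 \<Longrightarrow> s a = 0"
proof -
  define u where "u x = s x - s a" for x
  have u: "(u has_real_derivative s' x) (at x)" for x
    unfolding u_def using s by (auto intro!: derivative_eq_intros)
  have conts: "continuous_on A s" for A
    using s by (meson DERIV_isCont continuous_at_imp_continuous_on)
  have cont': "continuous_on A s'" for A
    using cont continuous_on_subset by blast
  have "integral {0..pi} (\<lambda>x. s' x ^ 2 - u x ^ 2) =
      integral {0..pi} (\<lambda>x. (s' x ^ 2 - s x ^ 2) + 2 * s a * s x - (s a)^2)"
    by (rule arg_cong[where f = "integral {0..pi}"]) (auto simp: u_def power2_eq_square algebra_simps)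
  also have "\<dots> = integral {0..pi} (\<lambda>x. (s' x ^ 2 - s x ^ 2) + 2 * s a * s x) - integral {0..pi} (\<lambda>x. (s a)^2)"
    by (intro Henstock_Kurzweil_Integration.integral_diff integrable_continuous_real continuous_intros conts cont')
  also have "\<dots> = integral {0..pi} (\<lambda>x. s' x ^ 2 - s x ^ 2) + integral {0..pi} (\<lambda>x. 2 * s a * s x) - integral {0..pi} (\<lambda>x. (s a)^2)"
    by (subst Henstock_Kurzweil_Integration.integral_add) (intro integrable_continuous_real continuous_intros conts cont' | simp)+
  also have "integral {0..pi} (\<lambda>x. 2 * s a * s x) = 0"
    using mean by simp
  finally have eq: "integral {0..pi} (\<lambda>x. s' x ^ 2 - u x ^ 2) = integral {0..pi} (\<lambda>x. s' x ^ 2 - s x ^ 2) - pi * (s a)\<^sup>2"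
    by simp
  have prem: "u (x + pi) ^ 2 = u x ^ 2" "s' (x + pi) ^ 2 = s' x ^ 2" "u a = 0" for x
    using per by (auto simp: u_def)
  note D = dirichlet_poincare_periodic[OF u cont prem]
  show "pi * (s a)\<^sup>2 \<le> integral {0..pi} (\<lambda>x. s' x ^ 2 - s x ^ 2)" using D(1) eq by simp
  assume "integral {0..pi} (\<lambda>x. s' x ^ 2 - s x ^ 2) = pi * (s a)\<^sup>2"
  then have "\<forall>x\<in>{a<..<a + pi}. u x = 0" using D(2) eq per by simp
  then have "s x = s a" if "x \<in> {a..a + pi}" for x
    using that per(1)[of a] by (auto simp: u_def less_le)
  then have "integral {a..a + pi} s = integral {a..a + pi} (\<lambda>x. s a)"
    by (rule Henstock_Kurzweil_Integration.integral_cong)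
  moreover have "integral {a..a + pi} s = integral {0..pi} s"
    using integral_periodic_shift[of s pi a 0] conts per by simp
  ultimately show "s a = 0" using mean by simp
qed

section \<open>The oriented plane\<close>

lemma unit_vec_nth [simp]: "unit_vec \<theta> $ 1 = cos \<theta>" "unit_vec \<theta> $ 2 = sin \<theta>"
  by (simp_all add: unit_vec_def)

text \<open>The quarter turn in the positive direction.\<close>

definition rot :: "real^2 \<Rightarrow> real^2" where
  "rot v = vector [- v $ 2, v $ 1]"

lemma rot_nth [simp]: "rot v $ 1 = - v $ 2" "rot v $ 2 = v $ 1"
  by (simp_all add: rot_def)

lemma vec2_eq_iff: "(x::real^2) = y \<longleftrightarrow> x $ 1 = y $ 1 \<and> x $ 2 = y $ 2"
  by (simp add: vec_eq_iff forall_2)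

lemma has_vector_derivative_vec2_iff:
  fixes f :: "real \<Rightarrow> real^2"
  shows "(f has_vector_derivative d) (at x) \<longleftrightarrow>
    ((\<lambda>t. f t $ 1) has_real_derivative d $ 1) (at x) \<and> ((\<lambda>t. f t $ 2) has_real_derivative d $ 2) (at x)"
proof -
  have b: "(Basis :: (real^2) set) = {axis 1 1, axis 2 1}"
    by (auto simp: Basis_vec_def UNIV_2)
  show ?thesis
    unfolding has_real_derivative_iff_has_vector_derivative has_vector_derivative_def
    by (subst has_derivative_componentwise_within) (simp add: b inner_axis)
qed

lemma inner_vec2: "(x::real^2) \<bullet> y = x $ 1 * y $ 1 + x $ 2 * y $ 2"
  by (simp add: inner_vec_def sum_2)

lemma norm_vec2: "norm (x::real^2) = sqrt ((x $ 1)\<^sup>2 + (x $ 2)\<^sup>2)"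
  by (simp add: norm_vec_def L2_set_def sum_2)

lemma norm_unit_vec: "norm (unit_vec \<theta>) = 1"
  by (simp add: norm_vec2)

lemma unit_vec_inner_self: "unit_vec \<theta> \<bullet> unit_vec \<theta> = 1"
  using norm_unit_vec norm_eq_1 by blast

lemma rot_orthogonal: "rot v \<bullet> v = 0"
  by (simp add: inner_vec2)

lemma cross2_inner_rot: "cross2 x y = rot x \<bullet> y"
  by (simp add: cross2_def inner_vec_def sum_2)

lemma unit_vec_pi: "unit_vec (\<theta> + pi) = - unit_vec \<theta>"
  by (simp add: vec2_eq_iff)

lemma unit_vec_eq_iff: "unit_vec \<alpha> = unit_vec \<beta> \<longleftrightarrow> (\<exists>n::int. \<alpha> = \<beta> + 2 * pi * n)"
  using sin_cos_eq_iff[of \<alpha> \<beta>] by (auto simp: vec2_eq_iff)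

lemma frame_decomposition:
  "v = (v \<bullet> unit_vec \<theta>) *\<^sub>R unit_vec \<theta> + (v \<bullet> rot (unit_vec \<theta>)) *\<^sub>R rot (unit_vec \<theta>)"
proof -
  have "v $ 1 * ((sin \<theta>)\<^sup>2 + (cos \<theta>)\<^sup>2) = ((v \<bullet> unit_vec \<theta>) *\<^sub>R unit_vec \<theta> + (v \<bullet> rot (unit_vec \<theta>)) *\<^sub>R rot (unit_vec \<theta>)) $ 1"
    "v $ 2 * ((sin \<theta>)\<^sup>2 + (cos \<theta>)\<^sup>2) = ((v \<bullet> unit_vec \<theta>) *\<^sub>R unit_vec \<theta> + (v \<bullet> rot (unit_vec \<theta>)) *\<^sub>R rot (unit_vec \<theta>)) $ 2"
    by (simp_all add: inner_vec2 algebra_simps power2_eq_square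
        del: sin_cos_squared_add sin_cos_squared_add2 sin_cos_squared_add3)
  then show ?thesis unfolding vec2_eq_iff[of v] by (simp only: sin_cos_squared_add mult_1_right)
qed

text \<open>
  Fubini's theorem for rectangles in \<open>real^2\<close>, transported from \<open>real \<times> real\<close> along the coordinate
  isomorphism, which maps boxes to boxes of the same content.
\<close>

lemma has_integral_vec2:
  fixes f :: "real \<times> real \<Rightarrow> real"
  assumes "continuous_on (cbox (a, c) (b, d)) f"
  shows "((\<lambda>z::real^2. f (z $ 1, z $ 2)) has_integral
      integral {a..b} (\<lambda>x. integral {c..d} (\<lambda>y. f (x, y)))) (cbox (vector [a, c]) (vector [b, d]))"
proof -
  define g :: "real^2 \<Rightarrow> real \<times> real" where "g z = (z $ 1, z $ 2)" for z
  define h :: "real \<times> real \<Rightarrow> real^2" where "h w = vector [fst w, snd w]" for w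
  have hg: "h (g z) = z" and gh: "g (h w) = w" for z w
    by (simp_all add: g_def h_def vec2_eq_iff)
  have mem: "z \<in> cbox u v \<longleftrightarrow> g z \<in> cbox (g u) (g v)" for z u v
    by (auto simp: g_def mem_box_cart forall_2)
  have gi: "g ` cbox u v = cbox (g u) (g v)" for u v
    using mem gh by (metis (no_types, lifting) image_eqI image_subsetI subsetI subset_antisym)
  have hi: "h ` cbox u v = cbox (h u) (h v)" for u v
  proof -
    have "h ` cbox u v = h ` (g ` cbox (h u) (h v))" by (simp add: gi gh)
    also have "\<dots> = cbox (h u) (h v)" by (simp add: image_image hg)
    finally show ?thesis .
  qed
  have cont: "measure lborel (g ` cbox u v) = 1 * measure lborel (cbox u v)" for u v
  proof -
    have "measure lborel (g ` cbox u v) = measure lborel (cbox (u $ 1) (v $ 1)) * measure lborel (cbox (u $ 2) (v $ 2))"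
      by (simp add: gi) (simp add: g_def content_Pair del: content_cbox_if)
    also have "\<dots> = measure lborel (cbox u v)"
    proof (cases "u $ 1 \<le> v $ 1 \<and> u $ 2 \<le> v $ 2")
      case True
      then have "cbox u v \<noteq> {}" by (simp add: interval_ne_empty_cart forall_2)
      then show ?thesis using True by (subst content_cbox_cart) (simp_all add: UNIV_2)
    next
      case False
      then have "\<exists>i. v $ i < u $ i" by (metis not_le)
      then have "cbox u v = {}" by (simp add: interval_eq_empty_cart)
      then show ?thesis using False by auto
    qed
    finally show ?thesis by simp
  qed
  have "(f has_integral integral {a..b} (\<lambda>x. integral {c..d} (\<lambda>y. f (x, y)))) (cbox (a, c) (b, d))"
    using integral_prod_continuous[OF assms] integrable_continuous[OF assms]
    by (metis cbox_interval integrable_integral)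
  moreover have "continuous (at z) g" for z
    unfolding g_def by (intro continuous_intros)
  ultimately have "((\<lambda>x. f (g x)) has_integral (1 / 1) *\<^sub>R integral {a..b} (\<lambda>x. integral {c..d} (\<lambda>y. f (x, y)))) (h ` cbox (a, c) (b, d))"
    using gi hi by (intro has_integral_twiddle[OF zero_less_one hg gh _ _ _ cont]) blast+
  then show ?thesis
    by (simp add: hi) (simp add: g_def h_def)
qed

section \<open>The inequality for a support function\<close>

lemma integral_two_halves:
  fixes f :: "real \<Rightarrow> real"
  assumes "continuous_on UNIV f"
  shows "integral {0..2 * pi} f = integral {0..pi} (\<lambda>x. f x + f (x + pi))"
proof -
  have c: "continuous_on A f" for A using assms continuous_on_subset by blast
  have c': "continuous_on A (\<lambda>x. f (x + pi))" for A
    by (rule continuous_on_compose2[OF assms]) (auto intro: continuous_intros)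
  have "integral {0..2 * pi} f = integral {0..pi} f + integral {pi..2 * pi} f"
    by (rule Henstock_Kurzweil_Integration.integral_combine[symmetric])
       (auto intro: integrable_continuous_real c)
  also have "integral {pi..2 * pi} f = integral {0..pi} (\<lambda>x. f (x + pi))"
    using integral_shift_Icc_real[of 0 pi f pi] by (simp add: o_def add.commute)
  finally show ?thesis
    by (simp add: Henstock_Kurzweil_Integration.integral_add integrable_continuous_real c c')
qed

text \<open>
  The left side is twice the area swept by a curve with support function \<open>g\<close>, because \<open>g + g2\<close> is its
  radius of curvature. The boundary condition holds on a full period, and also on half a period if
  \<open>g\<close> changes sign under the half turn.
\<close>

lemma integral_support_area_by_parts:
  fixes g g1 g2 :: "real \<Rightarrow> real"
  assumes g: "\<And>x. (g has_real_derivative g1 x) (at x)" and g1: "\<And>x. (g1 has_real_derivative g2 x) (at x)"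
    and cont: "continuous_on UNIV g2" and "a \<le> b" and bd: "g b * g1 b = g a * g1 a"
  shows "integral {a..b} (\<lambda>x. g x * (g x + g2 x)) = integral {a..b} (\<lambda>x. g x ^ 2 - g1 x ^ 2)"
proof -
  have c: "continuous_on A g" "continuous_on A g1" "continuous_on A g2" for A
    using g g1 cont by (meson DERIV_isCont continuous_at_imp_continuous_on continuous_on_subset subset_UNIV)+
  have "((\<lambda>x. g x * g1 x) has_real_derivative g1 x ^ 2 + g x * g2 x) (at x)" for x
    by (rule derivative_eq_intros g g1 refl | simp add: power2_eq_square)+
  from integral_of_derivative[OF this \<open>a \<le> b\<close>] bd
  have "integral {a..b} (\<lambda>x. g1 x ^ 2 + g x * g2 x) = 0"
    by (simp add: integral_unique)
  moreover have "integral {a..b} (\<lambda>x. g x * (g x + g2 x)) =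
      integral {a..b} (\<lambda>x. (g x ^ 2 - g1 x ^ 2) + (g1 x ^ 2 + g x * g2 x))"
    by (rule arg_cong[where f = "integral {a..b}"]) (auto simp: power2_eq_square algebra_simps)
  moreover have "\<dots> = integral {a..b} (\<lambda>x. g x ^ 2 - g1 x ^ 2) + integral {a..b} (\<lambda>x. g1 x ^ 2 + g x * g2 x)"
    by (intro Henstock_Kurzweil_Integration.integral_add integrable_continuous_real continuous_intros c)
  ultimately show ?thesis by simp
qed

lemma periodic_abs_max:
  fixes s :: "real \<Rightarrow> real"
  assumes "continuous_on UNIV s" "\<And>x. s (x + T) = s x" "T > 0"
  obtains a where "\<And>x. \<bar>s x\<bar> \<le> \<bar>s a\<bar>"
proof -
  interpret periodic_fun_simple s T by unfold_locales (rule assms)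
  have "continuous_on {0..T} (\<lambda>x. \<bar>s x\<bar>)"
    using assms(1) by (intro continuous_intros) (rule continuous_on_subset, auto)
  then obtain a where a: "\<And>x. x \<in> {0..T} \<Longrightarrow> \<bar>s x\<bar> \<le> \<bar>s a\<bar>"
    using continuous_attains_sup[of "{0..T}" "\<lambda>x. \<bar>s x\<bar>"] assms(3)
    by (metis atLeastAtMost_iff compact_Icc empty_iff less_imp_le order_refl)
  have "\<bar>s x\<bar> \<le> \<bar>s a\<bar>" for x
  proof -
    define n where "n = \<lfloor>x / T\<rfloor>"
    have "of_int n \<le> x / T" "x / T < of_int n + 1" by (simp_all add: n_def)
    then have "x - of_int n * T \<in> {0..T}"
      using assms(3) by (simp add: field_simps)
    moreover have "s x = s (x - of_int n * T)" using minus_of_int[of x n] by simp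
    ultimately show ?thesis using a by metis
  qed
  then show thesis using that by blast
qed

locale support_function =
  fixes p p1 p2 :: "real \<Rightarrow> real"
  assumes p: "\<And>x. (p has_real_derivative p1 x) (at x)"
    and p1: "\<And>x. (p1 has_real_derivative p2 x) (at x)"
    and p2: "continuous_on UNIV p2"
    and periodic: "\<And>x. p (x + 2 * pi) = p x"
begin

lemma shifts [derivative_intros]:
  "((\<lambda>x. p (x + c)) has_real_derivative p1 (x + c)) (at x)"
  "((\<lambda>x. p1 (x + c)) has_real_derivative p2 (x + c)) (at x)"
  using p[of "x + c"] p1[of "x + c"] by (simp_all add: DERIV_shift)

lemma periodic1: "p1 (x + 2 * pi) = p1 x"
  using DERIV_unique[OF shifts(1)[of "2 * pi" x]] p[of x] by (simp add: periodic)

lemma continuous: "continuous_on A p" "continuous_on A p1" "continuous_on A p2"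
  using p p1 p2 by (meson DERIV_isCont continuous_at_imp_continuous_on continuous_on_subset subset_UNIV)+

lemma continuous_shift:
  "continuous_on A (\<lambda>x. p (x + c))" "continuous_on A (\<lambda>x. p1 (x + c))" "continuous_on A (\<lambda>x. p2 (x + c))"
  by (rule continuous_on_compose2[OF continuous(1)[of UNIV]] continuous_on_compose2[OF continuous(2)[of UNIV]]
      continuous_on_compose2[OF continuous(3)[of UNIV]]; auto intro: continuous_intros)+

definition "even_part x = (p x + p (x + pi)) / 2"
definition "even_part1 x = (p1 x + p1 (x + pi)) / 2"
definition "odd_part x = (p x - p (x + pi)) / 2"
definition "odd_part1 x = (p1 x - p1 (x + pi)) / 2"
definition "odd_part2 x = (p2 x - p2 (x + pi)) / 2"

lemma shift_pi_pi: "p (x + pi + pi) = p x" "p1 (x + pi + pi) = p1 x"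
  using periodic[of x] periodic1[of x] by (simp_all only: mult_2 add.assoc)

lemma odd_part_pi:
  "odd_part (x + pi) = - odd_part x" "odd_part1 (x + pi) = - odd_part1 x"
  unfolding odd_part_def odd_part1_def shift_pi_pi by (simp_all add: field_simps)

lemma even_part_pi: "even_part (x + pi) = even_part x" "even_part1 (x + pi) = even_part1 x"
  unfolding even_part_def even_part1_def shift_pi_pi by (simp_all add: field_simps)

lemma odd_part: "(odd_part has_real_derivative odd_part1 x) (at x)"
  unfolding odd_part_def[abs_def] odd_part1_def by (rule derivative_eq_intros p refl | simp)+

lemma odd_part1: "(odd_part1 has_real_derivative odd_part2 x) (at x)"
  unfolding odd_part1_def[abs_def] odd_part2_def by (rule derivative_eq_intros p1 refl | simp)+

lemma even_part: "(even_part has_real_derivative even_part1 x) (at x)"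
  unfolding even_part_def[abs_def] even_part1_def by (rule derivative_eq_intros p refl | simp)+

lemma continuous_parts:
  "continuous_on A odd_part" "continuous_on A odd_part1" "continuous_on A odd_part2"
  "continuous_on A even_part" "continuous_on A even_part1"
  unfolding odd_part_def[abs_def] odd_part1_def[abs_def] odd_part2_def[abs_def]
    even_part_def[abs_def] even_part1_def[abs_def]
  by (auto intro!: continuous_intros continuous continuous_shift)

text \<open>
  The odd part changes sign between \<open>0\<close> and \<open>pi\<close>, so it has a zero, and Wirtinger's inequality applies
  from there on. Up to the factor \<open>1/2\<close> this says that the oriented area of the Wigner caustic is not
  positive.
\<close>

lemma odd_energy_nonneg: "integral {0..pi} (\<lambda>x. odd_part x ^ 2 - odd_part1 x ^ 2) \<le> 0"
proof -
  have "odd_part pi = - odd_part 0" using odd_part_pi(1)[of 0] by simp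
  moreover have "\<exists>a. odd_part a = 0"
  proof (cases "odd_part 0 \<le> 0")
    case True
    with calculation show ?thesis
      using IVT'[of odd_part 0 0 pi] continuous_parts(1) by auto
  next
    case False
    with calculation show ?thesis
      using IVT2'[of odd_part pi 0 0] continuous_parts(1) by auto
  qed
  then obtain a where "odd_part a = 0" by blast
  then have "0 \<le> integral {0..pi} (\<lambda>x. odd_part1 x ^ 2 - odd_part x ^ 2)"
    by (intro dirichlet_poincare_periodic[where a = a] odd_part continuous_parts) (simp_all add: odd_part_pi)
  then show ?thesis
    using Henstock_Kurzweil_Integration.integral_neg[of "{0..pi}" "\<lambda>x. odd_part x ^ 2 - odd_part1 x ^ 2"]
    by simp
qed

lemma length_eq: "integral {0..2 * pi} (\<lambda>x. p x + p2 x) = 2 * integral {0..pi} even_part"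
proof -
  have "integral {0..2 * pi} p2 = 0"
    using integral_of_derivative[OF p1, of 0 "2 * pi"] periodic1[of 0] by (simp add: integral_unique)
  then have "integral {0..2 * pi} (\<lambda>x. p x + p2 x) = integral {0..2 * pi} p"
    by (simp add: Henstock_Kurzweil_Integration.integral_add integrable_continuous_real continuous)
  also have "\<dots> = integral {0..pi} (\<lambda>x. p x + p (x + pi))"
    by (rule integral_two_halves[OF continuous(1)])
  also have "(\<lambda>x. p x + p (x + pi)) = (\<lambda>x. 2 * even_part x)"
    by (auto simp: even_part_def)
  finally show ?thesis by simp
qed

text \<open>
  The mixed products of the even and the odd part cancel between \<open>x\<close> and \<open>x + pi\<close>.
\<close>

lemma area_eq:
  "(1/2) * integral {0..2 * pi} (\<lambda>x. p x * (p x + p2 x)) =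
     integral {0..pi} (\<lambda>x. even_part x ^ 2 - even_part1 x ^ 2)
   + integral {0..pi} (\<lambda>x. odd_part x ^ 2 - odd_part1 x ^ 2)"
proof -
  have "integral {0..2 * pi} (\<lambda>x. p x * (p x + p2 x)) = integral {0..2 * pi} (\<lambda>x. p x ^ 2 - p1 x ^ 2)"
    using periodic[of 0] periodic1[of 0] by (intro integral_support_area_by_parts p p1 p2) auto
  also have "\<dots> = integral {0..pi} (\<lambda>x. (p x ^ 2 - p1 x ^ 2) + (p (x + pi) ^ 2 - p1 (x + pi) ^ 2))"
    by (intro integral_two_halves continuous_intros continuous)
  also have "\<dots> = integral {0..pi} (\<lambda>x. 2 * ((even_part x ^ 2 - even_part1 x ^ 2) + (odd_part x ^ 2 - odd_part1 x ^ 2)))"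
    by (rule arg_cong[where f = "integral {0..pi}"])
       (auto simp: even_part_def even_part1_def odd_part_def odd_part1_def power2_eq_square field_simps)
  also have "\<dots> = 2 * integral {0..pi} (\<lambda>x. (even_part x ^ 2 - even_part1 x ^ 2) + (odd_part x ^ 2 - odd_part1 x ^ 2))"
    by (rule integral_mult_right)
  also have "integral {0..pi} (\<lambda>x. (even_part x ^ 2 - even_part1 x ^ 2) + (odd_part x ^ 2 - odd_part1 x ^ 2)) =
      integral {0..pi} (\<lambda>x. even_part x ^ 2 - even_part1 x ^ 2)
      + integral {0..pi} (\<lambda>x. odd_part x ^ 2 - odd_part1 x ^ 2)"
    by (intro Henstock_Kurzweil_Integration.integral_add integrable_continuous_real continuous_intros continuous_parts)
  finally show ?thesis by simp
qed

lemma support_param_eq: "support_param p q \<theta> = q + p \<theta> *\<^sub>R unit_vec \<theta> + p1 \<theta> *\<^sub>R rot (unit_vec \<theta>)"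
  using DERIV_imp_deriv[OF p[of \<theta>]] by (simp add: support_param_def vec2_eq_iff)

lemma wigner_param_eq:
  "wigner_param p q \<theta> = q + odd_part \<theta> *\<^sub>R unit_vec \<theta> + odd_part1 \<theta> *\<^sub>R rot (unit_vec \<theta>)"
  by (simp add: wigner_param_def support_param_eq vec2_eq_iff odd_part_def odd_part1_def field_simps)

lemma wigner_param_velocity:
  "velocity (wigner_param p q) \<theta> = (odd_part \<theta> + odd_part2 \<theta>) *\<^sub>R rot (unit_vec \<theta>)"
proof -
  have "(wigner_param p q has_vector_derivative (odd_part \<theta> + odd_part2 \<theta>) *\<^sub>R rot (unit_vec \<theta>)) (at \<theta>)"
    unfolding has_vector_derivative_vec2_iff
    by (auto simp: wigner_param_eq algebra_simps intro!: derivative_eq_intros odd_part odd_part1)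
  then show ?thesis by (rule vector_derivative_at)
qed

text \<open>
  The choice of the origin \<open>q\<close> does not matter: it contributes the term \<open>?h\<close>, whose primitive \<open>?H\<close> is
  \<open>pi\<close>-periodic because both the odd part and the normal vector change sign under the half turn.
\<close>

lemma wigner_area_eq:
  "wigner_area p q = (1/2) * integral {0..pi} (\<lambda>x. odd_part x ^ 2 - odd_part1 x ^ 2)"
proof -
  let ?H = "\<lambda>x. odd_part1 x * (q \<bullet> unit_vec x) - odd_part x * (q \<bullet> rot (unit_vec x))"
  let ?h = "\<lambda>x. (odd_part x + odd_part2 x) * (q \<bullet> unit_vec x)"
  have ip: "q \<bullet> unit_vec x = q $ 1 * cos x + q $ 2 * sin x"
    "q \<bullet> rot (unit_vec x) = - q $ 1 * sin x + q $ 2 * cos x" for x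
    by (simp_all add: inner_vec_def sum_2)
  have "(?H has_real_derivative ?h x) (at x)" for x
    unfolding ip by (auto simp: algebra_simps intro!: derivative_eq_intros odd_part odd_part1)
  from integral_of_derivative[OF this, of 0 pi]
  have 0: "integral {0..pi} ?h = 0"
    using odd_part_pi[of 0] by (simp add: ip integral_unique)
  have "cross2 (wigner_param p q x) (velocity (wigner_param p q) x) =
    odd_part x * (odd_part x + odd_part2 x) + ?h x" for x
  proof -
    have "cross2 (wigner_param p q x) (velocity (wigner_param p q) x) =
      (odd_part x + odd_part2 x) * (odd_part x * ((sin x)\<^sup>2 + (cos x)\<^sup>2) + (q $ 1 * cos x + q $ 2 * sin x))"
      by (simp add: cross2_def wigner_param_eq wigner_param_velocity algebra_simps power2_eq_square
          del: sin_cos_squared_add sin_cos_squared_add2 sin_cos_squared_add3)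
    then show ?thesis
      unfolding sin_cos_squared_add ip by (simp add: algebra_simps)
  qed
  then have "wigner_area p q = (1/2) * integral {0..pi} (\<lambda>x. odd_part x * (odd_part x + odd_part2 x) + ?h x)"
    by (simp add: wigner_area_def)
  also have "integral {0..pi} (\<lambda>x. odd_part x * (odd_part x + odd_part2 x) + ?h x) =
      integral {0..pi} (\<lambda>x. odd_part x * (odd_part x + odd_part2 x)) + integral {0..pi} ?h"
    unfolding ip
    by (intro Henstock_Kurzweil_Integration.integral_add integrable_continuous_real continuous_intros continuous_parts)
  also have "integral {0..pi} (\<lambda>x. odd_part x * (odd_part x + odd_part2 x)) = integral {0..pi} (\<lambda>x. odd_part x ^ 2 - odd_part1 x ^ 2)"
    using odd_part_pi[of 0]
    by (intro integral_support_area_by_parts odd_part odd_part1 continuous_parts) auto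
  finally show ?thesis using 0 by simp
qed

text \<open>
  The odd part drops out of the left side, which becomes
  \<open>4 * pi * integral {0..pi} (\<lambda>x. even_part1 x ^ 2 - s x ^ 2)\<close> for the even part \<open>s\<close> reduced by its mean,
  and \<open>D\<close> is the maximum of \<open>\<bar>s\<bar>\<close>.
\<close>

lemma isoperimetric_wigner:
  fixes L A :: real
  assumes L: "L = integral {0..2 * pi} (\<lambda>x. p x + p2 x)"
    and A: "A = (1/2) * integral {0..2 * pi} (\<lambda>x. p x * (p x + p2 x))"
  defines "D \<equiv> d_infty p (wigner_type_support L p)"
  shows "L\<^sup>2 - 4 * pi * A - 8 * pi * \<bar>wigner_area p q\<bar> \<ge> 4 * pi\<^sup>2 * D\<^sup>2"
    and "L\<^sup>2 - 4 * pi * A - 8 * pi * \<bar>wigner_area p q\<bar> = 4 * pi\<^sup>2 * D\<^sup>2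
      \<longleftrightarrow> (\<exists>w. \<forall>x. p x + p (x + pi) = w)"
proof -
  define s where "s x = even_part x - L / (2 * pi)" for x
  have s: "(s has_real_derivative even_part1 x) (at x)" for x
    unfolding s_def[abs_def] by (auto intro!: derivative_eq_intros even_part)
  have conts: "continuous_on A s" for A
    unfolding s_def[abs_def] by (intro continuous_intros continuous_parts) auto
  have pers: "s (x + pi) = s x" for x by (simp add: s_def even_part_pi)
  have "integral {0..pi} s = integral {0..pi} even_part - integral {0..pi} (\<lambda>x. L / (2 * pi))"
    unfolding s_def[abs_def]
    by (intro Henstock_Kurzweil_Integration.integral_diff integrable_continuous_real continuous_intros continuous_parts) auto
  then have mean: "integral {0..pi} s = 0"
    using length_eq L by simp
  have "integral {0..pi} (\<lambda>x. even_part x ^ 2 - even_part1 x ^ 2) =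
    integral {0..pi} (\<lambda>x. - (even_part1 x ^ 2 - s x ^ 2) + (L / pi) * s x + (L / (2 * pi))^2)"
    by (rule arg_cong[where f = "integral {0..pi}"]) (auto simp: s_def power2_eq_square field_simps)
  also have "\<dots> = integral {0..pi} (\<lambda>x. - (even_part1 x ^ 2 - s x ^ 2)) + integral {0..pi} (\<lambda>x. (L / pi) * s x)
      + integral {0..pi} (\<lambda>x. (L / (2 * pi))^2)"
    by (simp only: Henstock_Kurzweil_Integration.integral_add integrable_continuous_real
        continuous_intros conts continuous_parts)
  also have "integral {0..pi} (\<lambda>x. (L / pi) * s x) = 0" using mean by simp
  finally have E: "integral {0..pi} (\<lambda>x. even_part x ^ 2 - even_part1 x ^ 2) =
      - integral {0..pi} (\<lambda>x. even_part1 x ^ 2 - s x ^ 2) + L^2 / (4 * pi)"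
    by (simp only: integral_neg) (simp add: power2_eq_square)
  have lhs: "L\<^sup>2 - 4 * pi * A - 8 * pi * \<bar>wigner_area p q\<bar> = 4 * pi * integral {0..pi} (\<lambda>x. even_part1 x ^ 2 - s x ^ 2)"
  proof -
    have "A = - integral {0..pi} (\<lambda>x. even_part1 x ^ 2 - s x ^ 2) + L^2 / (4 * pi) + 2 * wigner_area p q"
      using E A area_eq wigner_area_eq[of q] by simp
    moreover have "\<bar>wigner_area p q\<bar> = - wigner_area p q"
      using wigner_area_eq[of q] odd_energy_nonneg by simp
    ultimately show ?thesis by (simp only:) (simp add: field_simps)
  qed
  obtain a where a: "\<And>x. \<bar>s x\<bar> \<le> \<bar>s a\<bar>"
    using periodic_abs_max[of s pi] conts pers by auto
  have "p x - wigner_type_support L p x = s x" for x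
    by (simp add: s_def wigner_type_support_def even_part_def field_simps)
  then have D: "D = \<bar>s a\<bar>"
    unfolding D_def d_infty_def using a by (auto intro!: cSup_eq_maximum)
  have D2: "4 * pi\<^sup>2 * D\<^sup>2 = 4 * pi * (pi * (s a)\<^sup>2)" by (simp add: D power2_eq_square)
  note S = sup_bound_mean_zero_periodic[OF s continuous_parts(5) pers even_part_pi(2) mean, of a]
  show "L\<^sup>2 - 4 * pi * A - 8 * pi * \<bar>wigner_area p q\<bar> \<ge> 4 * pi\<^sup>2 * D\<^sup>2"
    unfolding lhs D2 using S(1) by simp
  show "L\<^sup>2 - 4 * pi * A - 8 * pi * \<bar>wigner_area p q\<bar> = 4 * pi\<^sup>2 * D\<^sup>2
      \<longleftrightarrow> (\<exists>w. \<forall>x. p x + p (x + pi) = w)"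
    unfolding lhs D2
  proof
    assume "4 * pi * integral {0..pi} (\<lambda>x. even_part1 x ^ 2 - s x ^ 2) = 4 * pi * (pi * (s a)\<^sup>2)"
    then have "s a = 0" using S(2) by simp
    then have s0: "s x = 0" for x using a[of x] by simp
    have "p x + p (x + pi) = L / pi" for x
    proof -
      have "p x + p (x + pi) = 2 * even_part x" by (simp add: even_part_def)
      also have "\<dots> = L / pi" using s0[of x] by (simp add: s_def)
      finally show ?thesis .
    qed
    then show "\<exists>w. \<forall>x. p x + p (x + pi) = w" by blast
  next
    assume "\<exists>w. \<forall>x. p x + p (x + pi) = w"
    then obtain w where "\<And>x. p x + p (x + pi) = w" by blast
    then have sc: "s = (\<lambda>x. w / 2 - L / (2 * pi))" by (simp add: s_def[abs_def] even_part_def)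
    then have "s x = 0" for x using mean by simp
    moreover have "even_part1 x = 0" for x
      using s[of x] DERIV_unique[of s _ x 0] sc by simp
    ultimately show "4 * pi * integral {0..pi} (\<lambda>x. even_part1 x ^ 2 - s x ^ 2) = 4 * pi * (pi * (s a)\<^sup>2)"
      by simp
  qed
qed

end

section \<open>Bodies parametrized by the angle of the outer normal\<close>

text \<open>
  A convex body whose boundary is traversed once, with the angle \<open>\<theta>\<close> of the outer normal as parameter.
  The velocity has the direction of the normal turned by a quarter, and \<open>\<rho>\<close> is the radius of curvature.
\<close>

locale normal_parametrization =
  fixes K :: "(real^2) set" and q :: "real^2" and X :: "real \<Rightarrow> real^2" and \<rho> :: "real \<Rightarrow> real"
  assumes compact: "compact K" and convex: "convex K" and q: "q \<in> interior K"
    and X: "\<And>\<theta>. (X has_vector_derivative \<rho> \<theta> *\<^sub>R rot (unit_vec \<theta>)) (at \<theta>)"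
    and \<rho>: "continuous_on UNIV \<rho>" and \<rho>_pos: "\<And>\<theta>. \<rho> \<theta> > 0"
    and X_periodic: "\<And>\<theta>. X (\<theta> + 2 * pi) = X \<theta>"
    and X_inj: "\<And>\<theta> \<eta>. X \<theta> = X \<eta> \<Longrightarrow> \<exists>n::int. \<eta> = \<theta> + of_int n * (2 * pi)"
    and X_range: "range X = frontier K"
    and X_outer: "\<And>\<theta> x. x \<in> K \<Longrightarrow> (x - X \<theta>) \<bullet> unit_vec \<theta> \<le> 0"
begin

definition "p \<theta> = (X \<theta> - q) \<bullet> unit_vec \<theta>"
definition "p1 \<theta> = (X \<theta> - q) \<bullet> rot (unit_vec \<theta>)"

lemma X_nth:
  "((\<lambda>\<theta>. X \<theta> $ 1) has_real_derivative - \<rho> \<theta> * sin \<theta>) (at \<theta>)"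
  "((\<lambda>\<theta>. X \<theta> $ 2) has_real_derivative \<rho> \<theta> * cos \<theta>) (at \<theta>)"
  using X[of \<theta>] by (simp_all add: has_vector_derivative_vec2_iff)

text \<open>
  The function \<open>p1\<close> is the derivative of the support function because \<open>X\<close> moves along its tangent line:
  only the rotation of the normal vector contributes. For the same reason \<open>\<rho> = p + p2\<close>.
\<close>

sublocale support_function p p1 "\<lambda>\<theta>. \<rho> \<theta> - p \<theta>"
proof
  fix x
  show dp: "(p has_real_derivative p1 x) (at x)" for x
    unfolding p_def[abs_def] p1_def inner_vec2
    by (auto simp: algebra_simps intro!: derivative_eq_intros X_nth)
  show "(p1 has_real_derivative \<rho> x - p x) (at x)"
    unfolding p_def[abs_def] p1_def[abs_def] inner_vec2
  proof (rule DERIV_cong)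
    show "((\<lambda>\<theta>. (X \<theta> - q) $ 1 * rot (unit_vec \<theta>) $ 1 + (X \<theta> - q) $ 2 * rot (unit_vec \<theta>) $ 2) has_real_derivative
      \<rho> x * ((sin x)\<^sup>2 + (cos x)\<^sup>2) - ((X x - q) $ 1 * cos x + (X x - q) $ 2 * sin x)) (at x)"
      by (auto simp: algebra_simps power2_eq_square simp del: sin_cos_squared_add sin_cos_squared_add3
          intro!: derivative_eq_intros X_nth)
  qed (simp add: p_def inner_vec2)
  show "continuous_on UNIV (\<lambda>\<theta>. \<rho> \<theta> - p \<theta>)"
    by (intro continuous_intros \<rho>) (meson dp DERIV_isCont continuous_at_imp_continuous_on)
  show "p (x + 2 * pi) = p x"
    by (simp add: p_def X_periodic inner_vec2)
qed

lemma K_iff: "x \<in> K \<longleftrightarrow> x \<in> interior K \<or> x \<in> range X"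
  using compact_imp_closed[OF compact] interior_subset[of K]
  by (auto simp: X_range frontier_def)

lemma p_pos: "p \<theta> > 0"
proof -
  obtain e where e: "e > 0" "ball q e \<subseteq> K" using q by (auto simp: mem_interior)
  then have "q + (e / 2) *\<^sub>R unit_vec \<theta> \<in> K" using e by (intro subsetD[OF e(2)]) (simp add: dist_norm norm_unit_vec)
  from X_outer[OF this, of \<theta>] have "(q - X \<theta>) \<bullet> unit_vec \<theta> + e / 2 * (unit_vec \<theta> \<bullet> unit_vec \<theta>) \<le> 0"
    by (simp add: inner_diff_left inner_add_left)
  then show ?thesis using e(1) by (simp add: p_def inner_diff_left unit_vec_inner_self)
qed

lemma ray_interior:
  assumes "0 \<le> r" "r < 1" shows "q + r *\<^sub>R (X \<theta> - q) \<in> interior K"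
proof -
  have "X \<theta> \<in> K" using K_iff by blast
  from mem_interior_convex_shrink[OF convex q this, of "1 - r"] assms
  show ?thesis by (simp add: algebra_simps)
qed

lemma X_not_interior: "X \<theta> \<notin> interior K"
  using X_range by (auto simp: frontier_def)

text \<open>
  The cone map from \<open>q\<close> over the boundary curve, in the coordinates radius and normal angle.
\<close>

definition "polar z = q + z $ 1 *\<^sub>R (X (z $ 2) - q)" for z :: "real^2"
definition "polar_domain = {z::real^2. 0 < z $ 1 \<and> z $ 1 \<le> 1 \<and> 0 \<le> z $ 2 \<and> z $ 2 < 2 * pi}"

text \<open>
  Points of a ray from \<open>q\<close> strictly before a boundary point are interior, so every ray meets the
  boundary only once.
\<close>

lemma polar_inj: "inj_on polar polar_domain"
proof -
  have radial: "z $ 1 \<ge> w $ 1" if "z \<in> polar_domain" "w \<in> polar_domain" and eq: "polar z = polar w" for z w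
  proof (rule ccontr)
    assume less: "\<not> z $ 1 \<ge> w $ 1"
    have w: "w $ 1 > 0" "z $ 1 > 0" using that by (auto simp: polar_domain_def)
    have "w $ 1 *\<^sub>R (X (w $ 2) - q) = z $ 1 *\<^sub>R (X (z $ 2) - q)" using eq by (simp add: polar_def)
    then have "(1 / w $ 1) *\<^sub>R w $ 1 *\<^sub>R (X (w $ 2) - q) = (1 / w $ 1) *\<^sub>R z $ 1 *\<^sub>R (X (z $ 2) - q)" by simp
    then have "X (w $ 2) = q + (z $ 1 / w $ 1) *\<^sub>R (X (z $ 2) - q)" using w by (simp add: algebra_simps)
    then show False
      using ray_interior[of "z $ 1 / w $ 1" "z $ 2"] X_not_interior[of "w $ 2"] w less by simp
  qed
  show ?thesis
  proof (rule inj_onI)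
    fix z w assume zw: "z \<in> polar_domain" "w \<in> polar_domain" and eq: "polar z = polar w"
    then have r: "z $ 1 = w $ 1" using radial[of z w] radial[of w z] by simp
    have "w $ 1 > 0" using zw by (simp add: polar_domain_def)
    then have "X (z $ 2) = X (w $ 2)" using eq r by (simp add: polar_def)
    then obtain n :: int where n: "w $ 2 = z $ 2 + of_int n * (2 * pi)" using X_inj by blast
    have "0 \<le> z $ 2" "z $ 2 < 2 * pi" "0 \<le> w $ 2" "w $ 2 < 2 * pi"
      using zw by (auto simp: polar_domain_def)
    then have "real_of_int n * (2 * pi) < 1 * (2 * pi)" "(-1) * (2 * pi) < real_of_int n * (2 * pi)"
      using n by linarith+
    then have "real_of_int n < 1" "-1 < real_of_int n"
      by (metis mult_less_cancel_right_pos pi_gt_zero zero_less_mult_iff zero_less_numeral)+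
    then have "n = 0" by linarith
    then show "z = w" using r n by (simp add: vec2_eq_iff)
  qed
qed

lemma X_angle: obtains \<eta> where "0 \<le> \<eta>" "\<eta> < 2 * pi" "X \<eta> = X \<theta>"
proof -
  interpret per: periodic_fun_simple X "2 * pi" by unfold_locales (rule X_periodic)
  define n where "n = \<lfloor>\<theta> / (2 * pi)\<rfloor>"
  have "of_int n \<le> \<theta> / (2 * pi)" "\<theta> / (2 * pi) < of_int n + 1" by (simp_all add: n_def)
  then have "0 \<le> \<theta> - of_int n * (2 * pi)" "\<theta> - of_int n * (2 * pi) < 2 * pi"
    by (simp_all add: field_simps)
  moreover have "X (\<theta> - of_int n * (2 * pi)) = X \<theta>" by (rule per.minus_of_int)
  ultimately show ?thesis using that by blast
qed

lemma polar_image: "polar ` polar_domain = K - {q}"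
proof (intro equalityI subsetI)
  fix y assume "y \<in> polar ` polar_domain"
  then obtain z where z: "z \<in> polar_domain" and y: "y = polar z" by blast
  have "X (z $ 2) \<in> K" using K_iff by blast
  then have "polar z \<in> K"
    using ray_interior[of "z $ 1" "z $ 2"] interior_subset[of K] z
    by (cases "z $ 1 = 1") (auto simp: polar_def polar_domain_def)
  moreover have "polar z \<noteq> q"
  proof
    assume "polar z = q"
    then have "X (z $ 2) = q" using z by (auto simp: polar_def polar_domain_def)
    then show False using X_not_interior[of "z $ 2"] q by simp
  qed
  ultimately show "y \<in> K - {q}" using y by simp
next
  fix x assume "x \<in> K - {q}"
  then have x: "x \<in> K" and nq: "x \<noteq> q" by auto
  obtain d where d: "0 < d" "q + d *\<^sub>R (x - q) \<in> frontier K"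
    using ray_to_frontier[OF compact_imp_bounded[OF compact] q, of "x - q"] nq by auto
  have d1: "d \<ge> 1"
  proof (rule ccontr)
    assume "\<not> d \<ge> 1"
    then have "x - (1 - d) *\<^sub>R (x - q) \<in> interior K"
      using d by (intro mem_interior_convex_shrink[OF convex q x]) auto
    moreover have "x - (1 - d) *\<^sub>R (x - q) = q + d *\<^sub>R (x - q)" by (simp add: algebra_simps)
    ultimately show False using d(2) by (simp add: frontier_def)
  qed
  obtain \<theta> where "q + d *\<^sub>R (x - q) = X \<theta>" using d(2) X_range by auto
  then obtain \<eta> where \<eta>: "0 \<le> \<eta>" "\<eta> < 2 * pi" "q + d *\<^sub>R (x - q) = X \<eta>"
    using X_angle[of \<theta>] by metis
  have "X \<eta> - q = d *\<^sub>R (x - q)" using \<eta>(3) by (simp add: algebra_simps)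
  then have "polar (vector [1 / d, \<eta>]) = x" using d by (simp add: polar_def)
  moreover have "vector [1 / d, \<eta>] \<in> polar_domain" using d d1 \<eta> by (simp add: polar_domain_def)
  ultimately show "x \<in> polar ` polar_domain" by blast
qed

definition "polar' z h = h $ 1 *\<^sub>R (X (z $ 2) - q) + (z $ 1 * h $ 2 * \<rho> (z $ 2)) *\<^sub>R rot (unit_vec (z $ 2))"
  for z h :: "real^2"

lemma polar_deriv: "(polar has_derivative polar' z) (at z within S)"
proof -
  have nth: "((\<lambda>z::real^2. z $ i) has_derivative (\<lambda>h. h $ i)) (at z within S)" for i
    by (rule bounded_linear.has_derivative[OF bounded_linear_vec_nth has_derivative_ident])
  have "(X has_derivative (\<lambda>t. t *\<^sub>R (\<rho> (z $ 2) *\<^sub>R rot (unit_vec (z $ 2))))) (at (z $ 2))"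
    using X by (simp add: has_vector_derivative_def)
  from has_derivative_compose[OF nth[of 2] this]
  have "((\<lambda>z. X (z $ 2)) has_derivative (\<lambda>h. (h $ 2) *\<^sub>R (\<rho> (z $ 2) *\<^sub>R rot (unit_vec (z $ 2))))) (at z within S)" .
  then show ?thesis
    unfolding polar_def[abs_def] polar'_def[abs_def]
    by (auto intro!: derivative_eq_intros nth simp: algebra_simps)
qed

lemma polar_det: "det (matrix (polar' z)) = z $ 1 * (p (z $ 2) * \<rho> (z $ 2))"
  by (simp add: det_2 matrix_def polar'_def axis_def p_def inner_vec2 algebra_simps)

text \<open>
  The cone map has the Jacobian \<open>r * p \<theta> * \<rho> \<theta>\<close> at \<open>(r, \<theta>)\<close>, and its image misses only the point \<open>q\<close>.
\<close>

lemma area: "measure lebesgue K = (1/2) * integral {0..2 * pi} (\<lambda>\<theta>. p \<theta> * \<rho> \<theta>)"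
proof -
  let ?B = "cbox (vector [0, 0]) (vector [1, 2 * pi]) :: (real^2) set"
  let ?f = "\<lambda>z::real^2. z $ 1 * (p (z $ 2) * \<rho> (z $ 2))"
  define I where "I = integral {0..2 * pi} (\<lambda>\<theta>. p \<theta> * \<rho> \<theta>)"
  have c2: "continuous_on A (\<lambda>w. snd w)" for A :: "(real \<times> real) set" by (intro continuous_intros)
  have "continuous_on (cbox (0, 0) (1, 2 * pi)) (\<lambda>w::real \<times> real. fst w * (p (snd w) * \<rho> (snd w)))"
    by (intro continuous_intros continuous_on_compose2[OF continuous(1)[of UNIV] c2] continuous_on_compose2[OF \<rho> c2]) auto
  from has_integral_vec2[OF this]
  have "(?f has_integral integral {0..1} (\<lambda>x. x * I)) ?B"
    by (simp add: I_def)
  moreover have "integral {0..1} (\<lambda>x::real. x * I) = (1/2) * I"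
  proof -
    have "((\<lambda>x. x^2 / 2) has_real_derivative x) (at x)" for x :: real
      by (auto intro!: derivative_eq_intros)
    from integral_of_derivative[OF this, of 0 1] show ?thesis by (simp add: integral_unique)
  qed
  ultimately have B: "(?f has_integral (1/2) * I) ?B" by simp
  have "negligible (?B - polar_domain)"
  proof (rule negligible_subset)
    show "negligible ({z::real^2. z $ 1 = 0} \<union> {z. z $ 2 = 2 * pi})"
      by (intro negligible_Un negligible_standard_hyperplane_cart)
         (simp add: cart_eq_inner_axis negligible_standard_hyperplane)
    show "?B - polar_domain \<subseteq> {z. z $ 1 = 0} \<union> {z. z $ 2 = 2 * pi}"
      by (auto simp: polar_domain_def mem_box_cart forall_2)
  qed
  moreover have "polar_domain - ?B = {}"
    by (auto simp: polar_domain_def mem_box_cart forall_2)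
  ultimately have P: "(?f has_integral (1/2) * I) polar_domain"
    by (intro has_integral_spike_set_eq[THEN iffD1, OF _ _ B]) (auto elim: negligible_subset)
  have lm: "polar_domain \<in> sets lebesgue"
  proof -
    have "polar_domain = {z. 0 < z $ 1} \<inter> {z. z $ 1 \<le> 1} \<inter> {z. 0 \<le> z $ 2} \<inter> {z. z $ 2 < 2 * pi}"
      by (auto simp: polar_domain_def)
    also have "\<dots> \<in> sets borel" by measurable
    finally show ?thesis by simp
  qed
  have nonneg: "\<bar>det (matrix (polar' z))\<bar> = ?f z" if "z \<in> polar_domain" for z
    using that p_pos[of "z $ 2"] \<rho>_pos[of "z $ 2"] by (simp add: polar_det polar_domain_def)
  have PD: "((\<lambda>z. \<bar>det (matrix (polar' z))\<bar>) has_integral (1/2) * I) polar_domain"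
    by (rule has_integral_eq[OF _ P]) (simp add: nonneg)
  have "measure lebesgue (polar ` polar_domain) = integral polar_domain (\<lambda>z. \<bar>det (matrix (polar' z))\<bar>)"
    using PD by (intro measure_differentiable_image_eq[OF lm polar_deriv polar_inj]) (auto simp: integrable_on_def)
  then have "measure lebesgue (K - {q}) = (1/2) * I"
    using PD by (simp add: polar_image integral_unique)
  moreover have "measure lebesgue (K - {q}) = measure lebesgue K"
    using lmeasurable_compact[OF compact] by (intro measure_negligible_symdiff) (auto intro: negligible_subset[of "{q}"])
  ultimately show ?thesis by (simp add: I_def)
qed

text \<open>
  In normal form, the two tangent lines with opposite normals are level sets of the same linear
  functional, so that their distance can be read off.
\<close>

definition "tangent \<theta> = {x. (x - q) \<bullet> unit_vec \<theta> = p \<theta>}"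

lemma tangent_as_line:
  assumes "c \<noteq> 0"
  shows "{X \<theta> + s *\<^sub>R (c *\<^sub>R rot (unit_vec \<theta>)) | s. True} = tangent \<theta>"
proof (intro equalityI subsetI)
  fix x assume "x \<in> {X \<theta> + s *\<^sub>R (c *\<^sub>R rot (unit_vec \<theta>)) | s. True}"
  then obtain s where "x = X \<theta> + s *\<^sub>R (c *\<^sub>R rot (unit_vec \<theta>))" by blast
  then show "x \<in> tangent \<theta>"
    by (simp add: tangent_def p_def inner_add_left inner_diff_left rot_orthogonal)
next
  fix x assume "x \<in> tangent \<theta>"
  then have "(x - X \<theta>) \<bullet> unit_vec \<theta> = 0" by (simp add: tangent_def p_def inner_diff_left)
  moreover define r where "r = (x - X \<theta>) \<bullet> rot (unit_vec \<theta>)"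
  ultimately have "x - X \<theta> = r *\<^sub>R rot (unit_vec \<theta>)"
    using frame_decomposition[of "x - X \<theta>" \<theta>] by simp
  then have "x = X \<theta> + (r / c) *\<^sub>R (c *\<^sub>R rot (unit_vec \<theta>))"
    using assms by (simp add: diff_eq_eq add.commute)
  then show "x \<in> {X \<theta> + s *\<^sub>R (c *\<^sub>R rot (unit_vec \<theta>)) | s. True}" by blast
qed

lemma tangent_pi: "tangent (\<theta> + pi) = {x. (x - q) \<bullet> unit_vec \<theta> = - p (\<theta> + pi)}"
  unfolding tangent_def unit_vec_pi by auto

lemma tangent_mod:
  assumes "\<eta> = \<theta> + of_int n * pi"
  shows "tangent \<eta> = (if even n then tangent \<theta> else tangent (\<theta> + pi))"
proof -
  interpret per: periodic_fun_simple p "2 * pi" by unfold_locales (rule periodic)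
  interpret peru: periodic_fun_simple unit_vec "2 * pi" by unfold_locales (simp add: vec2_eq_iff)
  have per2: "tangent (\<theta> + of_int k * (2 * pi)) = tangent \<theta>" for \<theta> k
    unfolding tangent_def per.plus_of_int peru.plus_of_int ..
  show "tangent \<eta> = (if even n then tangent \<theta> else tangent (\<theta> + pi))"
  proof (cases "even n")
    case True
    then obtain k where "n = 2 * k" by (elim evenE)
    then have "\<eta> = \<theta> + of_int k * (2 * pi)" using assms by simp
    then show ?thesis using True per2 by simp
  next
    case False
    then obtain k where "n = 2 * k + 1" by (elim oddE)
    then have "\<eta> = (\<theta> + pi) + of_int k * (2 * pi)" using assms by (simp add: algebra_simps)
    then show ?thesis using False per2[of "\<theta> + pi" k] by simp
  qed
qed

lemma opposite_tangents_distinct: "tangent \<theta> \<noteq> tangent (\<theta> + pi)"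
proof
  assume eq: "tangent \<theta> = tangent (\<theta> + pi)"
  have "X \<theta> \<in> tangent \<theta>" by (simp add: tangent_def p_def)
  then show False
    using eq p_pos[of \<theta>] p_pos[of "\<theta> + pi"] by (auto simp: tangent_pi p_def[symmetric])
qed

text \<open>
  By the Cauchy-Schwarz inequality no two points of the lines are closer than the difference of the
  two levels, which is attained by moving from \<open>X \<theta>\<close> along the normal.
\<close>

lemma setdist_opposite_tangents: "setdist (tangent \<theta>) (tangent (\<theta> + pi)) = p \<theta> + p (\<theta> + pi)"
proof -
  let ?d = "p \<theta> + p (\<theta> + pi)" and ?u = "unit_vec \<theta>"
  have d: "?d > 0" using p_pos[of \<theta>] p_pos[of "\<theta> + pi"] by simp
  define y where "y = X \<theta> - ?d *\<^sub>R ?u"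
  have dy: "dist (X \<theta>) y = ?d" using d by (simp add: norm_unit_vec y_def dist_norm)
  have "setdist (tangent \<theta>) (tangent (\<theta> + pi)) = dist (X \<theta>) y"
  proof (rule setdist_unique)
    show "X \<theta> \<in> tangent \<theta>" by (simp add: tangent_def p_def)
    have "(y - q) \<bullet> ?u = p \<theta> - ?d"
      by (simp add: y_def p_def inner_diff_left unit_vec_inner_self algebra_simps)
    then show "y \<in> tangent (\<theta> + pi)" by (simp add: tangent_pi)
    fix a b assume "a \<in> tangent \<theta> \<and> b \<in> tangent (\<theta> + pi)"
    then have "(a - q) \<bullet> ?u - (b - q) \<bullet> ?u = ?d" by (simp add: tangent_pi) (simp add: tangent_def)
    then have "(a - b) \<bullet> ?u = ?d" by (simp add: inner_diff_left)
    then have "?d \<le> norm (a - b)" using norm_cauchy_schwarz[of "a - b" ?u] by (simp add: norm_unit_vec)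
    then show "dist (X \<theta>) y \<le> dist a b" unfolding dy by (simp add: dist_norm)
  qed
  then show ?thesis by (simp add: dy)
qed

end

section \<open>The normal angle of a closed convex curve\<close>

text \<open>
  From an interior point one can move a little in the direction of \<open>u\<close> without leaving the set.
\<close>

lemma interior_not_maximizer:
  fixes K :: "'a::real_inner set"
  assumes m: "m \<in> interior K" and max: "\<And>z. z \<in> K \<Longrightarrow> (z - m) \<bullet> u \<le> 0"
  shows "u = 0"
proof (rule ccontr)
  assume "u \<noteq> 0"
  obtain e where e: "e > 0" "ball m e \<subseteq> K" using m by (auto simp: mem_interior)
  have "m + (e / (2 * norm u)) *\<^sub>R u \<in> K"
    using e \<open>u \<noteq> 0\<close> by (intro subsetD[OF e(2)]) (simp add: dist_norm)
  from max[OF this] have "e / (2 * norm u) * (u \<bullet> u) \<le> 0" by simp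
  moreover have "e / (2 * norm u) * (u \<bullet> u) > 0" using e \<open>u \<noteq> 0\<close> by simp
  ultimately show False by simp
qed

text \<open>
  The midpoint of two points with the same outer normal would be interior and still maximal in
  this direction.
\<close>

lemma support_point_unique:
  assumes K: "strictly_convex K" and xy: "x \<in> K" "y \<in> K" and "u \<noteq> 0"
    and x: "\<And>z. z \<in> K \<Longrightarrow> (z - x) \<bullet> u \<le> 0" and y: "\<And>z. z \<in> K \<Longrightarrow> (z - y) \<bullet> u \<le> 0"
  shows "x = y"
proof (rule ccontr)
  assume "x \<noteq> y"
  then have m: "midpoint x y \<in> interior K"
    using K xy midpoint_in_open_segment unfolding strictly_convex_def by blast
  have "(z - midpoint x y) \<bullet> u \<le> 0" if "z \<in> K" for z
  proof -
    have "(z - midpoint x y) \<bullet> u = ((z - x) \<bullet> u + (z - y) \<bullet> u) / 2"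
      by (simp add: midpoint_def inner_diff_left inner_add_left field_simps)
    then show ?thesis using x[OF that] y[OF that] by simp
  qed
  from interior_not_maximizer[OF m this] show False using \<open>u \<noteq> 0\<close> by simp
qed

lemma second_derivative_nonpos_at_max:
  fixes f f1 :: "real \<Rightarrow> real"
  assumes f: "\<And>x. (f has_real_derivative f1 x) (at x)" and f1: "(f1 has_real_derivative d) (at t)"
    and max: "\<And>x. f x \<le> f t"
  shows "f1 t = 0" "d \<le> 0"
proof -
  show z: "f1 t = 0"
    using DERIV_local_max[OF f zero_less_one] max by blast
  show "d \<le> 0"
  proof (rule ccontr)
    assume "\<not> d \<le> 0"
    then obtain e where e: "e > 0" "\<And>h. 0 < h \<Longrightarrow> h < e \<Longrightarrow> f1 t < f1 (t + h)"
      using DERIV_pos_inc_right[OF f1] by auto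
    obtain z where z': "t < z" "z < t + e / 2" "f (t + e / 2) - f t = (t + e / 2 - t) * f1 z"
      using MVT2[of t "t + e / 2" f f1] f e(1) by auto
    have "f1 z > 0" using e(2)[of "z - t"] z' z e(1) by simp
    then have "(t + e / 2 - t) * f1 z > 0" using e(1) by simp
    then have "f (t + e / 2) - f t > 0" using z'(3) by linarith
    then show False using max[of "t + e / 2"] by simp
  qed
qed

text \<open>
  A regular parametrization, of period one and positively curved, of the boundary of a strictly convex
  body. A negatively curved one is brought into this form by reversing its direction.
\<close>

locale convex_boundary_curve =
  fixes K :: "(real^2) set" and q :: "real^2" and g g1 g2 :: "real \<Rightarrow> real^2"
  assumes compact: "compact K" and strictly_convex_K: "strictly_convex K" and q: "q \<in> interior K"
    and g: "\<And>t. (g has_vector_derivative g1 t) (at t)"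
    and g1: "\<And>t. (g1 has_vector_derivative g2 t) (at t)"
    and g2: "continuous_on UNIV g2"
    and g_periodic: "\<And>t. g (t + 1) = g t"
    and g_inj: "\<And>s t. g s = g t \<Longrightarrow> \<exists>n::int. t = s + of_int n"
    and g_range: "range g = frontier K"
    and turning: "\<And>t. cross2 (g1 t) (g2 t) > 0"
begin

lemma nth_deriv:
  "((\<lambda>t. g t $ 1) has_real_derivative g1 t $ 1) (at t)" "((\<lambda>t. g t $ 2) has_real_derivative g1 t $ 2) (at t)"
  "((\<lambda>t. g1 t $ 1) has_real_derivative g2 t $ 1) (at t)" "((\<lambda>t. g1 t $ 2) has_real_derivative g2 t $ 2) (at t)"
  using g[of t] g1[of t] by (simp_all add: has_vector_derivative_vec2_iff)

lemma g1_periodic: "g1 (t + 1) = g1 t"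
proof -
  have "((\<lambda>t. g (t + 1)) has_vector_derivative g1 (t + 1)) (at t)"
    using nth_deriv[of "t + 1"] by (simp add: has_vector_derivative_vec2_iff DERIV_shift)
  then show ?thesis
    using g[of t] vector_derivative_unique_at by (simp add: g_periodic) blast
qed

lemma g2_periodic: "g2 (t + 1) = g2 t"
proof -
  have "((\<lambda>t. g1 (t + 1)) has_vector_derivative g2 (t + 1)) (at t)"
    using nth_deriv[of "t + 1"] by (simp add: has_vector_derivative_vec2_iff DERIV_shift)
  then show ?thesis
    using g1[of t] vector_derivative_unique_at by (simp add: g1_periodic) blast
qed

lemma g1_nonzero: "g1 t \<noteq> 0"
  using turning[of t] by (auto simp: cross2_def)

definition "speed t = norm (g1 t)"

lemma speed_pos: "speed t > 0"
  using g1_nonzero by (simp add: speed_def)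

lemma speed_square: "(speed t)\<^sup>2 = (g1 t $ 1)\<^sup>2 + (g1 t $ 2)\<^sup>2"
  by (simp add: speed_def norm_vec2)

lemma speed_deriv:
  "(speed has_real_derivative (g1 t $ 1 * g2 t $ 1 + g1 t $ 2 * g2 t $ 2) / speed t) (at t)"
proof -
  have pos: "(g1 t $ 1)\<^sup>2 + (g1 t $ 2)\<^sup>2 > 0"
    using speed_square[of t] speed_pos[of t] by (metis zero_less_power)
  have "((\<lambda>t. sqrt ((g1 t $ 1)\<^sup>2 + (g1 t $ 2)\<^sup>2)) has_real_derivative
     (g1 t $ 1 * g2 t $ 1 + g1 t $ 2 * g2 t $ 2) * inverse (sqrt ((g1 t $ 1)\<^sup>2 + (g1 t $ 2)\<^sup>2))) (at t)"
  proof (rule DERIV_cong)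
    show "((\<lambda>t. sqrt ((g1 t $ 1)\<^sup>2 + (g1 t $ 2)\<^sup>2)) has_real_derivative
       inverse (sqrt ((g1 t $ 1)\<^sup>2 + (g1 t $ 2)\<^sup>2)) / 2 * (2 * g1 t $ 1 * g2 t $ 1 + 2 * g1 t $ 2 * g2 t $ 2)) (at t)"
      by (intro DERIV_chain2[where f = sqrt and g = "\<lambda>t. (g1 t $ 1)\<^sup>2 + (g1 t $ 2)\<^sup>2"] DERIV_real_sqrt pos) (auto intro!: derivative_eq_intros nth_deriv)
  qed (simp add: algebra_simps)
  moreover have "speed = (\<lambda>t. sqrt ((g1 t $ 1)\<^sup>2 + (g1 t $ 2)\<^sup>2))"
    by (simp add: fun_eq_iff speed_def norm_vec2)
  ultimately show ?thesis by (simp add: divide_inverse distrib_right)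
qed

definition "turning_rate t = cross2 (g1 t) (g2 t) / (speed t)\<^sup>2"

lemma turning_rate_periodic: "turning_rate (t + 1) = turning_rate t"
  unfolding turning_rate_def speed_def g1_periodic g2_periodic ..

lemma turning_rate_pos: "turning_rate t > 0"
  using turning[of t] speed_pos[of t] by (simp add: turning_rate_def)

lemma turning_rate_continuous: "continuous_on A turning_rate"
proof -
  have 1: "continuous_on A g1" for A
    using g1 by (meson continuous_at_imp_continuous_on has_vector_derivative_continuous)
  have 2: "continuous_on A g2" for A using g2 continuous_on_subset by blast
  show ?thesis
    unfolding turning_rate_def[abs_def] cross2_def speed_def
    by (intro continuous_intros 1 2) (use g1_nonzero in auto)
qed

text \<open>
  The lift of the tangent direction to an angle, shifted by a quarter turn so that it is the angle of the
  normal: integrate the turning rate, starting from the right angle at parameter zero. The component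
  \<open>P\<close> of the velocity along the turned unit vector satisfies the same linear differential equation as
  the speed, so that their quotient keeps its initial value 1. Hence the velocity has no other component.
\<close>

lemma tangent_angle_exists:
  "\<exists>\<phi>. (\<forall>t. (\<phi> has_real_derivative turning_rate t) (at t)) \<and> (\<forall>t. g1 t = speed t *\<^sub>R rot (unit_vec (\<phi> t)))"
proof -
  obtain \<phi>0 where \<phi>0: "\<And>t. (\<phi>0 has_real_derivative turning_rate t) (at t)"
    using antiderivative_on_line[OF turning_rate_continuous] by blast
  have "(g1 0 $ 2 / speed 0)\<^sup>2 + (- g1 0 $ 1 / speed 0)\<^sup>2 = 1"
    using speed_pos[of 0]
    unfolding power_divide power2_minus add_divide_distrib[symmetric] by (simp add: speed_square[symmetric] add.commute)
  then obtain c where c: "g1 0 $ 2 / speed 0 = cos c" "- g1 0 $ 1 / speed 0 = sin c"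
    using sincos_total_2pi by metis
  define \<phi> where "\<phi> t = \<phi>0 t - \<phi>0 0 + c" for t
  have \<phi>: "(\<phi> has_real_derivative turning_rate t) (at t)" for t
    unfolding \<phi>_def[abs_def] using \<phi>0 by (auto intro!: derivative_eq_intros)
  define P where "P t = g1 t $ 2 * cos (\<phi> t) - g1 t $ 1 * sin (\<phi> t)" for t
  have "((\<lambda>t. P t / speed t) has_real_derivative 0) (at t)" for t
  proof -
    let ?a = "g1 t $ 1" and ?b = "g1 t $ 2" and ?a' = "g2 t $ 1" and ?b' = "g2 t $ 2"
    let ?k = "turning_rate t" and ?C = "cos (\<phi> t)" and ?S = "sin (\<phi> t)"
    let ?P' = "?b' * ?C - ?a' * ?S - ?k * (?b * ?S + ?a * ?C)"
    have P': "(P has_real_derivative ?P') (at t)"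
      unfolding P_def[abs_def]
      by (auto intro!: derivative_eq_intros nth_deriv \<phi> simp: algebra_simps)
    have nz: "speed t \<noteq> 0" using speed_pos[of t] by simp
    have k: "?k * (?a\<^sup>2 + ?b\<^sup>2) = ?a * ?b' - ?b * ?a'"
      using nz unfolding speed_square[symmetric] by (simp add: turning_rate_def cross2_def)
    have "?P' * (?a\<^sup>2 + ?b\<^sup>2) = (?b' * ?C - ?a' * ?S) * (?a\<^sup>2 + ?b\<^sup>2) - (?k * (?a\<^sup>2 + ?b\<^sup>2)) * (?b * ?S + ?a * ?C)"
      by (simp add: algebra_simps)
    also have "\<dots> = P t * (?a * ?a' + ?b * ?b')"
      unfolding k P_def by (simp add: algebra_simps power2_eq_square)
    finally have key: "?P' * (speed t)\<^sup>2 = P t * (?a * ?a' + ?b * ?b')"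
      by (simp add: speed_square)
    have "((\<lambda>t. P t / speed t) has_real_derivative
        (?P' * speed t - P t * ((?a * ?a' + ?b * ?b') / speed t)) / (speed t * speed t)) (at t)"
      by (rule DERIV_divide[OF P' speed_deriv nz])
    moreover have "?P' * speed t - P t * ((?a * ?a' + ?b * ?b') / speed t) = 0"
      using key nz by (simp add: field_simps power2_eq_square)
    ultimately show ?thesis by simp
  qed
  then have const: "P t / speed t = P 0 / speed 0" for t
    using DERIV_isconst_all by blast
  have "P 0 / speed 0 = (g1 0 $ 2 / speed 0) * cos c + (- g1 0 $ 1 / speed 0) * sin c"
    unfolding P_def \<phi>_def by (simp add: diff_divide_distrib)
  then have "P 0 / speed 0 = cos c * cos c + sin c * sin c"
    unfolding c .
  then have P: "P t = speed t" for t
    using const[of t] speed_pos[of t] by (simp add: field_simps flip: power2_eq_square)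
  have "g1 t = speed t *\<^sub>R rot (unit_vec (\<phi> t))" for t
  proof -
    define C where "C = g1 t $ 1 * cos (\<phi> t) + g1 t $ 2 * sin (\<phi> t)"
    have "C\<^sup>2 + (P t)\<^sup>2 = ((g1 t $ 1)\<^sup>2 + (g1 t $ 2)\<^sup>2) * ((sin (\<phi> t))\<^sup>2 + (cos (\<phi> t))\<^sup>2)"
      unfolding C_def P_def by (simp add: algebra_simps power2_eq_square del: sin_cos_squared_add sin_cos_squared_add2 sin_cos_squared_add3)
    then have "C = 0" using P[of t] speed_square[of t] by simp
    have "g1 t $ 1 * ((sin (\<phi> t))\<^sup>2 + (cos (\<phi> t))\<^sup>2) = C * cos (\<phi> t) - P t * sin (\<phi> t)"
      "g1 t $ 2 * ((sin (\<phi> t))\<^sup>2 + (cos (\<phi> t))\<^sup>2) = C * sin (\<phi> t) + P t * cos (\<phi> t)"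
      unfolding C_def P_def by (simp_all add: algebra_simps power2_eq_square del: sin_cos_squared_add sin_cos_squared_add2 sin_cos_squared_add3)
    then show ?thesis using \<open>C = 0\<close> P by (simp add: vec2_eq_iff)
  qed
  then show ?thesis using \<phi> by blast
qed

text \<open>
  The angle of the outer normal as a continuous function of the curve parameter. It is determined up
  to a multiple of \<open>2 * pi\<close>, and any choice will do.
\<close>

definition "\<phi> = (SOME \<phi>. (\<forall>t. (\<phi> has_real_derivative turning_rate t) (at t)) \<and>
   (\<forall>t. g1 t = speed t *\<^sub>R rot (unit_vec (\<phi> t))))"

lemma \<phi>: "(\<phi> has_real_derivative turning_rate t) (at t)"
  and g1_eq: "g1 t = speed t *\<^sub>R rot (unit_vec (\<phi> t))"
  using someI_ex[OF tangent_angle_exists] unfolding \<phi>_def[symmetric] by blast+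

lemma convex_K: "convex K"
  using strictly_convex_K by (simp add: strictly_convex_def)

lemma g_in_K: "g t \<in> K"
  using g_range compact_imp_closed[OF compact] by (auto simp: frontier_def)

text \<open>
  There is a supporting line at \<open>g t\<close>. Its outer normal \<open>b\<close> is orthogonal to the velocity, since the
  linear functional \<open>b\<close> restricted to the curve is maximal at \<open>t\<close>, so it is a multiple of
  \<open>unit_vec (\<phi> t)\<close>. The second derivative at this maximum is not positive, and the sign of the
  curvature then decides which of the two unit normals points outwards.
\<close>

lemma outer:
  assumes "x \<in> K" shows "(x - g t) \<bullet> unit_vec (\<phi> t) \<le> 0"
proof -
  have ri: "rel_interior K = interior K"
    using q rel_interior_nonempty_interior by blast
  have "g t \<notin> interior K" using g_range by (auto simp: frontier_def)
  then obtain a where a: "a \<noteq> 0" "\<And>y. y \<in> K \<Longrightarrow> a \<bullet> g t \<le> a \<bullet> y"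
    using supporting_hyperplane_rel_boundary[OF convex_K g_in_K, of t] ri by metis
  define b where "b = - a"
  have b: "b \<noteq> 0" "\<And>y. y \<in> K \<Longrightarrow> y \<bullet> b \<le> g t \<bullet> b"
    using a by (auto simp: b_def inner_commute)
  have "((\<lambda>s. g s \<bullet> b) has_real_derivative g1 s \<bullet> b) (at s)" "((\<lambda>s. g1 s \<bullet> b) has_real_derivative g2 s \<bullet> b) (at s)" for s
    by (simp_all add: inner_vec_def sum_2) (auto intro!: derivative_eq_intros nth_deriv)
  from second_derivative_nonpos_at_max[OF this, of t] b(2)[OF g_in_K]
  have o: "g1 t \<bullet> b = 0" "g2 t \<bullet> b \<le> 0" by auto
  define n where "n = unit_vec (\<phi> t)"
  define c where "c = b \<bullet> n"
  have rn: "rot n \<bullet> b = 0" using o(1) speed_pos[of t] by (simp add: g1_eq n_def)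
  have bn: "b = c *\<^sub>R n"
  proof -
    have *: "- sin (\<phi> t) * b $ 1 + cos (\<phi> t) * b $ 2 = 0"
      using rn by (simp add: n_def inner_vec_def sum_2)
    have "b $ 1 * ((sin (\<phi> t))\<^sup>2 + (cos (\<phi> t))\<^sup>2) = c * cos (\<phi> t) - sin (\<phi> t) * (- sin (\<phi> t) * b $ 1 + cos (\<phi> t) * b $ 2)"
      "b $ 2 * ((sin (\<phi> t))\<^sup>2 + (cos (\<phi> t))\<^sup>2) = c * sin (\<phi> t) + cos (\<phi> t) * (- sin (\<phi> t) * b $ 1 + cos (\<phi> t) * b $ 2)"
      unfolding c_def n_def by (simp_all add: inner_vec_def sum_2 algebra_simps power2_eq_square del: sin_cos_squared_add sin_cos_squared_add2 sin_cos_squared_add3)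
    then show ?thesis unfolding * by (simp add: vec2_eq_iff n_def)
  qed
  have "rot (g1 t) = - speed t *\<^sub>R n" by (simp add: g1_eq n_def vec2_eq_iff)
  then have "speed t * (n \<bullet> g2 t) < 0" using turning[of t] by (simp add: cross2_inner_rot)
  then have "n \<bullet> g2 t < 0" using speed_pos[of t] by (simp add: mult_less_0_iff)
  then have "c \<ge> 0" using o(2) bn by (simp add: inner_commute mult_le_0_iff)
  then have "c > 0" using b(1) bn by (cases "c = 0") auto
  have "(x - g t) \<bullet> b \<le> 0" using b(2)[OF assms] by (simp add: inner_diff_left)
  then have "c * ((x - g t) \<bullet> n) \<le> 0" using bn by simp
  then show ?thesis using \<open>c > 0\<close> by (simp add: n_def mult_le_0_iff)
qed

lemma same_normal:
  assumes "unit_vec (\<phi> s) = unit_vec (\<phi> t)" shows "g s = g t"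
proof (rule support_point_unique[OF strictly_convex_K g_in_K g_in_K])
  show "unit_vec (\<phi> t) \<noteq> 0" using norm_unit_vec[of "\<phi> t"] by (metis norm_zero zero_neq_one)
  show "(z - g s) \<bullet> unit_vec (\<phi> t) \<le> 0" if "z \<in> K" for z
    using outer[OF that, of s] by (simp only: assms)
qed (rule outer)

lemma \<phi>_strict_mono: "s < t \<Longrightarrow> \<phi> s < \<phi> t"
  by (rule DERIV_pos_imp_increasing) (use \<phi> turning_rate_pos in blast)+

lemma \<phi>_continuous: "continuous_on A \<phi>"
  by (rule continuous_at_imp_continuous_on) (use \<phi> DERIV_isCont in blast)

text \<open>
  The normal returns after one traversal, so the angle grows by a multiple of a full turn, which is
  positive by monotonicity. If it were two turns or more, the normal at parameter zero would occur again
  strictly inside the period, at the same boundary point, although the curve is simple.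
\<close>

lemma \<phi>_period: "\<phi> (t + 1) = \<phi> t + 2 * pi"
proof -
  have const: "\<phi> (s + 1) - \<phi> s = \<phi> (0 + 1) - \<phi> 0" for s
    using constant_difference_of_periodic_derivative[of \<phi> turning_rate 1 s 0, OF \<phi> turning_rate_periodic] .
  have "rot (unit_vec (\<phi> 1)) = rot (unit_vec (\<phi> 0))"
  proof (rule scaleR_left_imp_eq)
    show "speed 0 \<noteq> 0" using speed_pos[of 0] by simp
    show "speed 0 *\<^sub>R rot (unit_vec (\<phi> 1)) = speed 0 *\<^sub>R rot (unit_vec (\<phi> 0))"
      using g1_eq[of 1] g1_eq[of 0] g1_periodic[of 0] unfolding speed_def by (metis add_0)
  qed
  then have "unit_vec (\<phi> 1) = unit_vec (\<phi> 0)" by (simp add: vec2_eq_iff)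
  then obtain n :: int where n: "\<phi> 1 = \<phi> 0 + 2 * pi * n" using unit_vec_eq_iff by blast
  have "2 * pi * n > 0" using n \<phi>_strict_mono[of 0 1] by simp
  then have "n \<ge> 1" by (simp add: zero_less_mult_iff)
  moreover have "\<not> n \<ge> 2"
  proof
    assume "n \<ge> 2"
    then have "2 * pi * n \<ge> 2 * pi * 2" by (intro mult_left_mono) auto
    then have "\<phi> 0 + 2 * pi < \<phi> 1" using n pi_gt_zero by linarith
    then obtain t where t: "0 \<le> t" "t \<le> 1" "\<phi> t = \<phi> 0 + 2 * pi"
      using IVT'[of \<phi> 0 "\<phi> 0 + 2 * pi" 1] \<phi>_continuous by auto
    have "unit_vec (\<phi> t) = unit_vec (\<phi> 0)" by (simp add: t(3) vec2_eq_iff)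
    then obtain k :: int where k: "t = 0 + of_int k" using same_normal g_inj by metis
    have "t \<noteq> 0" "t \<noteq> 1" using t(3) \<open>\<phi> 0 + 2 * pi < \<phi> 1\<close> pi_gt_zero by auto
    then have "0 < t" "t < 1" using t by auto
    then show False using k by simp
  qed
  ultimately have "n = 1" by simp
  then show ?thesis using const[of t] n by simp
qed

lemma \<phi>_of_int: "\<phi> (t + of_int n) = \<phi> t + of_int n * (2 * pi)"
proof -
  interpret per: periodic_fun_simple "\<lambda>t. \<phi> t - t * (2 * pi)" 1
    by unfold_locales (simp add: \<phi>_period algebra_simps)
  show ?thesis using per.plus_of_int[of t n] by (simp add: algebra_simps)
qed

lemma \<phi>_surj: "\<exists>t. \<phi> t = y"
proof -
  \<comment> \<open>After \<open>n\<close> turns in either direction the angle has passed \<open>y\<close>.\<close>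
  define n where "n = \<lceil>\<bar>y - \<phi> 0\<bar>\<rceil>"
  have n: "\<bar>y - \<phi> 0\<bar> \<le> of_int n" "0 \<le> n" by (simp_all add: n_def)
  have "of_int n * 1 \<le> of_int n * (2 * pi)"
    using n(2) pi_ge_two by (intro mult_left_mono) auto
  then have "\<phi> (of_int (- n)) \<le> y" "y \<le> \<phi> (of_int n)"
    using n(1) \<phi>_of_int[of 0 n] \<phi>_of_int[of 0 "- n"] by auto
  then show ?thesis
    using IVT'[of \<phi> "of_int (- n)" y "of_int n"] n(2) \<phi>_continuous by auto
qed

definition "\<tau> = inv \<phi>"

lemma \<phi>_inj: "inj \<phi>"
  by (rule injI) (metis \<phi>_strict_mono less_irrefl linorder_neqE)

lemma \<tau>_\<phi> [simp]: "\<tau> (\<phi> t) = t"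
  by (simp add: \<tau>_def \<phi>_inj)

lemma \<phi>_\<tau> [simp]: "\<phi> (\<tau> y) = y"
  using \<phi>_surj[of y] by auto

lemma \<tau>: "(\<tau> has_real_derivative inverse (turning_rate (\<tau> \<theta>))) (at \<theta>)"
proof -
  have "(\<tau> has_derivative (*) (inverse (turning_rate (\<tau> \<theta>)))) (at \<theta>)"
    by (rule has_derivative_inverse_strong_x[of UNIV _ _ \<phi>])
       (use \<phi>[of "\<tau> \<theta>"] \<phi>_continuous turning_rate_pos[of "\<tau> \<theta>"] in
         \<open>auto simp: has_field_derivative_def fun_eq_iff\<close>)
  then show ?thesis by (simp add: has_field_derivative_def)
qed

definition "X \<theta> = g (\<tau> \<theta>)"
definition "\<rho> \<theta> = speed (\<tau> \<theta>) / turning_rate (\<tau> \<theta>)"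

lemma g1_\<tau>: "g1 (\<tau> \<theta>) = speed (\<tau> \<theta>) *\<^sub>R rot (unit_vec \<theta>)"
  by (subst g1_eq) simp

lemma \<rho>_continuous: "continuous_on UNIV \<rho>"
proof -
  have t: "continuous_on UNIV \<tau>"
    using \<tau> by (meson DERIV_isCont continuous_at_imp_continuous_on)
  have s: "continuous_on UNIV speed"
    using speed_deriv by (meson DERIV_isCont continuous_at_imp_continuous_on)
  show ?thesis
    unfolding \<rho>_def[abs_def]
    by (intro continuous_intros continuous_on_compose2[OF s t] continuous_on_compose2[OF turning_rate_continuous t])
       (use turning_rate_pos in \<open>auto simp: less_imp_neq[symmetric] intro: less_imp_neq\<close>)
qed

sublocale normal_parametrization K q X \<rho>
proof
  fix \<theta> \<eta> x
  show "compact K" "convex K" "q \<in> interior K" by (fact compact convex_K q)+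
  have "((g \<circ> \<tau>) has_vector_derivative inverse (turning_rate (\<tau> \<theta>)) *\<^sub>R g1 (\<tau> \<theta>)) (at \<theta>)"
    using \<tau> g by (intro vector_diff_chain_at) (simp_all add: has_real_derivative_iff_has_vector_derivative)
  moreover have "X = g \<circ> \<tau>" by (simp add: fun_eq_iff X_def)
  ultimately show "(X has_vector_derivative \<rho> \<theta> *\<^sub>R rot (unit_vec \<theta>)) (at \<theta>)"
    by (simp add: g1_\<tau> \<rho>_def divide_inverse mult.commute)
  show "continuous_on UNIV \<rho>" by (rule \<rho>_continuous)
  show "\<rho> \<theta> > 0" using speed_pos turning_rate_pos by (simp add: \<rho>_def)
  show "X (\<theta> + 2 * pi) = X \<theta>"
    using \<phi>_period[of "\<tau> \<theta>"] g_periodic[of "\<tau> \<theta>"] \<tau>_\<phi>[of "\<tau> \<theta> + 1"] by (simp add: X_def)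
  show "\<exists>n::int. \<eta> = \<theta> + of_int n * (2 * pi)" if "X \<theta> = X \<eta>"
    using that g_inj[of "\<tau> \<theta>" "\<tau> \<eta>"] \<phi>_of_int[of "\<tau> \<theta>"] unfolding X_def by (metis \<phi>_\<tau>)
  have "range \<tau> = UNIV" by (metis \<tau>_\<phi> surjI)
  then show "range X = frontier K"
    using g_range unfolding X_def[abs_def] by (metis image_image)
  show "(x - X \<theta>) \<bullet> unit_vec \<theta> \<le> 0" if "x \<in> K"
    using outer[OF that, of "\<tau> \<theta>"] by (simp add: X_def)
qed

text \<open>
  Substitution \<open>\<theta> = \<phi> t\<close>, carried out on a primitive of \<open>\<rho>\<close>. Only the total turn matters and not the
  angle at which the traversal starts, because \<open>\<rho>\<close> is periodic.
\<close>

lemma length_by_angle: "integral {0..1} speed = integral {0..2 * pi} \<rho>"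
proof -
  obtain R where R: "\<And>x. (R has_real_derivative \<rho> x) (at x)"
    using antiderivative_on_line[OF \<rho>_continuous] by blast
  have "((\<lambda>t. R (\<phi> t)) has_real_derivative speed t) (at t)" for t
  proof -
    have "\<rho> (\<phi> t) * turning_rate t = speed t"
      using turning_rate_pos[of t] by (simp add: \<rho>_def)
    then show ?thesis using DERIV_chain2[OF R \<phi>, of t] by simp
  qed
  from integral_of_derivative[OF this, of 0 1]
  have "integral {0..1} speed = R (\<phi> 0 + 2 * pi) - R (\<phi> 0)"
    using \<phi>_period[of 0] by (simp add: integral_unique)
  also have "\<dots> = integral {\<phi> 0..\<phi> 0 + 2 * pi} \<rho>"
    using integral_of_derivative[OF R, of "\<phi> 0" "\<phi> 0 + 2 * pi"] by (simp add: integral_unique)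
  also have "\<dots> = integral {0..0 + 2 * pi} \<rho>"
  proof (rule integral_periodic_shift[OF \<rho>_continuous])
    show "\<rho> (\<theta> + 2 * pi) = \<rho> \<theta>" for \<theta>
      using \<phi>_period[of "\<tau> \<theta>"] \<tau>_\<phi>[of "\<tau> \<theta> + 1"]
      by (simp add: \<rho>_def turning_rate_def speed_def g1_periodic g2_periodic)
  qed simp
  finally show ?thesis by simp
qed

text \<open>
  The given curve \<open>\<gamma>\<close> and its positively oriented version \<open>g\<close> differ by the sign \<open>\<sigma>\<close> of the parameter.
\<close>

context
  fixes \<gamma> :: "real \<Rightarrow> real^2" and \<sigma> :: real
  assumes \<sigma>: "\<sigma> * \<sigma> = 1"
    and \<gamma>: "\<And>t. \<gamma> t = g (\<sigma> * t)" and velocity_\<gamma>: "\<And>t. velocity \<gamma> t = \<sigma> *\<^sub>R g1 (\<sigma> * t)"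
begin

lemma \<gamma>_by_angle:
  "\<gamma> t = X (\<phi> (\<sigma> * t))" "velocity \<gamma> t = (\<sigma> * speed (\<sigma> * t)) *\<^sub>R rot (unit_vec (\<phi> (\<sigma> * t)))"
  using g1_eq[of "\<sigma> * t"] by (simp_all add: \<gamma> velocity_\<gamma> X_def)

lemma angle_attained: obtains t where "\<phi> (\<sigma> * t) = \<theta>"
proof
  show "\<phi> (\<sigma> * (\<sigma> * \<tau> \<theta>)) = \<theta>" using \<sigma> by (simp flip: mult.assoc)
qed

lemma support_fun_eq: "support_fun K \<gamma> q = p"
proof
  fix \<theta>
  obtain t where t: "\<phi> (\<sigma> * t) = \<theta>" by (rule angle_attained)
  have nt: "outer_normal K \<gamma> t (unit_vec \<theta>)"
    using \<gamma>_by_angle[of t] X_outer by (simp add: outer_normal_def norm_unit_vec t rot_orthogonal)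
  show "support_fun K \<gamma> q \<theta> = p \<theta>"
    unfolding support_fun_def
  proof (rule the_equality)
    show "\<exists>t. outer_normal K \<gamma> t (unit_vec \<theta>) \<and> p \<theta> = (\<gamma> t - q) \<bullet> unit_vec \<theta>"
      using nt \<gamma>_by_angle[of t] t by (auto simp: p_def)
    fix h assume "\<exists>t. outer_normal K \<gamma> t (unit_vec \<theta>) \<and> h = (\<gamma> t - q) \<bullet> unit_vec \<theta>"
    then obtain s where s: "outer_normal K \<gamma> s (unit_vec \<theta>)" "h = (\<gamma> s - q) \<bullet> unit_vec \<theta>" by blast
    have "\<gamma> s = X \<theta>"
    proof (rule support_point_unique[OF strictly_convex_K])
      show "\<gamma> s \<in> K" "X \<theta> \<in> K" using g_in_K by (simp_all add: \<gamma> X_def)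
      show "unit_vec \<theta> \<noteq> 0" using norm_unit_vec[of \<theta>] by auto
    qed (use s(1) X_outer in \<open>auto simp: outer_normal_def\<close>)
    then show "h = p \<theta>" using s(2) by (simp add: p_def)
  qed
qed

lemma tangent_line_eq: "tangent_line \<gamma> t = tangent (\<phi> (\<sigma> * t))"
proof -
  have "\<sigma> * speed (\<sigma> * t) \<noteq> 0" using \<sigma> speed_pos[of "\<sigma> * t"] by auto
  from tangent_as_line[OF this] show ?thesis
    by (simp add: tangent_line_def \<gamma>_by_angle)
qed

text \<open>
  Two tangent lines are parallel exactly if their normal angles differ by a multiple of \<open>pi\<close>. For an
  even multiple the lines coincide, for an odd one they are opposite tangents, at the distance computed
  above.
\<close>

lemma constant_width_iff: "constant_width \<gamma> \<longleftrightarrow> (\<exists>w. \<forall>\<theta>. p \<theta> + p (\<theta> + pi) = w)"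
proof -
  have cross: "cross2 (velocity \<gamma> s) (velocity \<gamma> t) = 0 \<longleftrightarrow> sin (\<phi> (\<sigma> * t) - \<phi> (\<sigma> * s)) = 0" for s t
  proof -
    have "cross2 (velocity \<gamma> s) (velocity \<gamma> t) =
      (\<sigma> * \<sigma>) * (speed (\<sigma> * s) * speed (\<sigma> * t)) * sin (\<phi> (\<sigma> * t) - \<phi> (\<sigma> * s))"
      by (simp add: cross2_def \<gamma>_by_angle sin_diff algebra_simps)
    then show ?thesis using \<sigma> speed_pos[of "\<sigma> * s"] speed_pos[of "\<sigma> * t"] by simp
  qed
  have parallel: "\<exists>n::int. \<phi> (\<sigma> * t) = \<phi> (\<sigma> * s) + of_int n * pi"
    if "cross2 (velocity \<gamma> s) (velocity \<gamma> t) = 0" for s t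
    using that cross sin_zero_iff_int2[of "\<phi> (\<sigma> * t) - \<phi> (\<sigma> * s)"] by (auto simp: algebra_simps)
  show ?thesis
  proof
    assume "constant_width \<gamma>"
    then obtain w where w: "\<forall>s t. cross2 (velocity \<gamma> s) (velocity \<gamma> t) = 0 \<and>
        tangent_line \<gamma> s \<noteq> tangent_line \<gamma> t \<longrightarrow> setdist (tangent_line \<gamma> s) (tangent_line \<gamma> t) = w"
      unfolding constant_width_def by (rule exE)
    have "p \<theta> + p (\<theta> + pi) = w" for \<theta>
    proof -
      obtain s where s: "\<phi> (\<sigma> * s) = \<theta>" by (rule angle_attained)
      obtain t where t: "\<phi> (\<sigma> * t) = \<theta> + pi" by (rule angle_attained)
      show ?thesis
        using s t w[rule_format, of s t] opposite_tangents_distinct[of \<theta>] setdist_opposite_tangents[of \<theta>]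
        by (simp add: cross tangent_line_eq)
    qed
    then show "\<exists>w. \<forall>\<theta>. p \<theta> + p (\<theta> + pi) = w" by blast
  next
    assume "\<exists>w. \<forall>\<theta>. p \<theta> + p (\<theta> + pi) = w"
    then obtain w where w: "\<And>\<theta>. p \<theta> + p (\<theta> + pi) = w" by blast
    show "constant_width \<gamma>"
      unfolding constant_width_def
    proof (intro exI[of _ w] allI impI, elim conjE)
      fix s t
      assume par: "cross2 (velocity \<gamma> s) (velocity \<gamma> t) = 0" and ne: "tangent_line \<gamma> s \<noteq> tangent_line \<gamma> t"
      obtain n :: int where "\<phi> (\<sigma> * t) = \<phi> (\<sigma> * s) + of_int n * pi" using parallel[OF par] by blast
      from tangent_mod[OF this] ne have "tangent_line \<gamma> t = tangent (\<phi> (\<sigma> * s) + pi)"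
        by (auto simp: tangent_line_eq split: if_splits)
      then show "setdist (tangent_line \<gamma> s) (tangent_line \<gamma> t) = w"
        by (simp add: tangent_line_eq setdist_opposite_tangents w)
    qed
  qed
qed

lemma isoperimetric_wigner_curve:
  defines "L \<equiv> integral {0..1} speed"
  shows "L\<^sup>2 - 4 * pi * measure lebesgue K - 8 * pi * \<bar>wigner_area (support_fun K \<gamma> q) q\<bar>
           \<ge> 4 * pi\<^sup>2 * (d_infty (support_fun K \<gamma> q) (wigner_type_support L (support_fun K \<gamma> q)))\<^sup>2
       \<and> (L\<^sup>2 - 4 * pi * measure lebesgue K - 8 * pi * \<bar>wigner_area (support_fun K \<gamma> q) q\<bar>
           = 4 * pi\<^sup>2 * (d_infty (support_fun K \<gamma> q) (wigner_type_support L (support_fun K \<gamma> q)))\<^sup>2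
         \<longleftrightarrow> constant_width \<gamma>)"
proof -
  have "L = integral {0..2 * pi} (\<lambda>\<theta>. p \<theta> + (\<rho> \<theta> - p \<theta>))"
    by (simp add: L_def length_by_angle)
  moreover have "measure lebesgue K = (1/2) * integral {0..2 * pi} (\<lambda>\<theta>. p \<theta> * (p \<theta> + (\<rho> \<theta> - p \<theta>)))"
    by (simp add: area)
  ultimately show ?thesis
    unfolding support_fun_eq constant_width_iff using isoperimetric_wigner[of L "measure lebesgue K" q] by blast
qed

end

end

section \<open>Ovals\<close>

lemma simple_loop_inj:
  fixes \<gamma> :: "real \<Rightarrow> 'a::topological_space"
  assumes "simple_path \<gamma>" and per: "\<And>t. \<gamma> (t + 1) = \<gamma> t" and eq: "\<gamma> s = \<gamma> t"
  shows "\<exists>n::int. t = s + of_int n"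
proof -
  interpret periodic_fun_simple \<gamma> 1 by unfold_locales (rule per)
  have f: "\<gamma> (frac r) = \<gamma> r" for r
    using minus_of_int[of r "\<lfloor>r\<rfloor>"] by (simp add: frac_def)
  have "\<gamma> (frac s) = \<gamma> (frac t)" using eq f by simp
  moreover have "frac s \<in> {0..1}" "frac t \<in> {0..1}" "frac s \<noteq> 1" "frac t \<noteq> 1"
    using frac_lt_1[of s] frac_lt_1[of t] by auto
  ultimately have "frac s = frac t"
    using assms(1) unfolding simple_path_def loop_free_def by blast
  then have "t = s + of_int (\<lfloor>t\<rfloor> - \<lfloor>s\<rfloor>)" by (simp add: frac_def)
  then show ?thesis by blast
qed

lemma oval_derivatives:
  assumes "oval \<gamma>"
  shows "(\<gamma> has_vector_derivative velocity \<gamma> t) (at t)"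
    and "(velocity \<gamma> has_vector_derivative velocity (velocity \<gamma>) t) (at t)"
    and "continuous_on A (velocity (velocity \<gamma>))"
proof -
  have d: "(velocity ^^ n) \<gamma> differentiable (at t)" for n t
    using assms by (simp add: oval_def smooth_curve_def)
  show "(\<gamma> has_vector_derivative velocity \<gamma> t) (at t)"
    using d[of 0 t] by (simp add: vector_derivative_works)
  show "(velocity \<gamma> has_vector_derivative velocity (velocity \<gamma>) t) (at t)"
    using d[of 1 t] by (simp add: vector_derivative_works)
  show "continuous_on A (velocity (velocity \<gamma>))"
    using d[of 2] by (auto simp: numeral_2_eq_2 intro!: continuous_at_imp_continuous_on differentiable_imp_continuous_within)
qed

lemma oval_range: "oval \<gamma> \<Longrightarrow> range \<gamma> = path_image \<gamma>"
proof -
  assume "oval \<gamma>"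
  then interpret periodic_fun_simple \<gamma> 1 by unfold_locales (simp add: oval_def)
  have "\<gamma> (frac r) = \<gamma> r" for r
    using minus_of_int[of r "\<lfloor>r\<rfloor>"] by (simp add: frac_def)
  moreover have "frac r \<in> {0..1}" for r :: real using frac_lt_1[of r] by simp
  ultimately have "\<gamma> r \<in> \<gamma> ` {0..1}" for r by (metis imageI)
  then show ?thesis unfolding path_image_def by blast
qed

theorem theorem4p4:
  fixes K :: "(real^2) set" and \<gamma> :: "real \<Rightarrow> real^2" and q :: "real^2"
    and p :: "real \<Rightarrow> real" and A L :: real
  assumes "compact K" and "strictly_convex K"
    and "oval \<gamma>" and "frontier K = path_image \<gamma>"
    and "q \<in> interior K"
  defines "p \<equiv> support_fun K \<gamma> q"
    and "A \<equiv> measure lebesgue K"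
    and "L \<equiv> curve_length \<gamma>"
  shows "L\<^sup>2 - 4 * pi * A - 8 * pi * \<bar>wigner_area p q\<bar>
           \<ge> 4 * pi\<^sup>2 * (d_infty p (wigner_type_support L p))\<^sup>2
       \<and> (L\<^sup>2 - 4 * pi * A - 8 * pi * \<bar>wigner_area p q\<bar>
           = 4 * pi\<^sup>2 * (d_infty p (wigner_type_support L p))\<^sup>2
         \<longleftrightarrow> constant_width \<gamma>)"
proof -
  have per: "\<gamma> (t + 1) = \<gamma> t" and simple: "simple_path \<gamma>" and nz: "velocity \<gamma> t \<noteq> 0" for t
    using \<open>oval \<gamma>\<close> by (simp_all add: oval_def)
  interpret per: periodic_fun_simple \<gamma> 1 by unfold_locales (rule per)
  note d = oval_derivatives[OF \<open>oval \<gamma>\<close>]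
  obtain \<sigma> :: real where \<sigma>: "\<sigma> = 1 \<or> \<sigma> = -1" and curv: "\<And>t. \<sigma> * signed_curvature \<gamma> t > 0"
  proof (cases "\<forall>t. signed_curvature \<gamma> t > 0")
    case True then show ?thesis using that[of 1] by simp
  next
    case False
    then have "\<forall>t. signed_curvature \<gamma> t < 0" using \<open>oval \<gamma>\<close> unfolding oval_def by blast
    then show ?thesis using that[of "-1"] by simp
  qed
  have \<sigma>2: "\<sigma> * \<sigma> = 1" using \<sigma> by auto
  have pos: "\<sigma> * cross2 (velocity \<gamma> t) (velocity (velocity \<gamma>) t) > 0" for t
  proof -
    have "\<sigma> * cross2 (velocity \<gamma> t) (velocity (velocity \<gamma>) t) = norm (velocity \<gamma> t) ^ 3 * (\<sigma> * signed_curvature \<gamma> t)"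
      using nz[of t] by (simp add: signed_curvature_def)
    also have "\<dots> > 0" using nz[of t] by (intro mult_pos_pos[OF _ curv]) simp
    finally show ?thesis .
  qed
  define g g1 g2 where "g t = \<gamma> (\<sigma> * t)" and "g1 t = \<sigma> *\<^sub>R velocity \<gamma> (\<sigma> * t)"
    and "g2 t = velocity (velocity \<gamma>) (\<sigma> * t)" for t
  have scale: "((\<lambda>t. f (\<sigma> * t)) has_vector_derivative \<sigma> *\<^sub>R f') (at t)"
    if "(f has_vector_derivative f') (at (\<sigma> * t))" for f :: "real \<Rightarrow> real^2" and f' t
    using vector_diff_chain_at[of "\<lambda>t. \<sigma> * t" \<sigma> t f f'] that
    by (simp add: o_def has_vector_derivative_mult_right[OF has_vector_derivative_id, of \<sigma>, simplified])
  interpret C: convex_boundary_curve K q g g1 g2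
  proof
    fix t s
    show "(g has_vector_derivative g1 t) (at t)"
      unfolding g_def[abs_def] g1_def by (rule scale[OF d(1)])
    have "(g1 has_vector_derivative \<sigma> *\<^sub>R \<sigma> *\<^sub>R g2 t) (at t)"
      unfolding g1_def[abs_def] g2_def using has_vector_derivative_scaleR[OF DERIV_const[of \<sigma>] scale[OF d(2)]] by simp
    then show "(g1 has_vector_derivative g2 t) (at t)" using \<sigma>2 by simp
    show "continuous_on UNIV g2"
      unfolding g2_def[abs_def] by (rule continuous_on_compose2[OF d(3)[of UNIV]]) (auto intro: continuous_intros)
    show "g (t + 1) = g t"
      using \<sigma> per[of t] per.minus_1[of "- t"] by (auto simp: g_def)
    show "\<exists>n::int. t = s + of_int n" if eq: "g s = g t"
    proof -
      obtain n :: int where n: "\<sigma> * t = \<sigma> * s + of_int n"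
        using simple_loop_inj[OF simple per] eq unfolding g_def by blast
      show ?thesis
      proof (cases "\<sigma> = 1")
        case True then show ?thesis using n by auto
      next
        case False
        then have "t = s + of_int (- n)" using n \<sigma> by simp
        then show ?thesis by blast
      qed
    qed
    have "\<gamma> r = g (\<sigma> * r)" for r using \<sigma>2 by (simp add: g_def flip: mult.assoc)
    then have "range g = range \<gamma>" by (auto simp: g_def[abs_def])
    then show "range g = frontier K"
      using oval_range[OF \<open>oval \<gamma>\<close>] assms(4) by simp
    show "cross2 (g1 t) (g2 t) > 0"
      using pos[of "\<sigma> * t"] by (simp add: g1_def g2_def cross2_def algebra_simps)
  qed (use assms in auto)
  have \<gamma>: "\<gamma> t = g (\<sigma> * t)" "velocity \<gamma> t = \<sigma> *\<^sub>R g1 (\<sigma> * t)" for t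
    using \<sigma>2 by (simp_all add: g_def g1_def flip: mult.assoc)
  have v: "continuous_on UNIV (\<lambda>t. norm (velocity \<gamma> t))"
    using d(2) by (intro continuous_intros) (meson continuous_at_imp_continuous_on has_vector_derivative_continuous)
  have vper: "velocity \<gamma> (t + 1) = velocity \<gamma> t" for t
    using \<sigma> C.g1_periodic[of t] C.g1_periodic[of "- t - 1"] by (auto simp: \<gamma>(2))
  have "integral {0..1} C.speed = integral {0..1} (\<lambda>t. norm (velocity \<gamma> (\<sigma> * t)))"
    using \<sigma> by (intro arg_cong[where f = "integral {0..1}"]) (auto simp: C.speed_def g1_def fun_eq_iff)
  also have "\<dots> = integral {0..1} (\<lambda>t. norm (velocity \<gamma> t))"
  proof (cases "\<sigma> = 1")
    case False
    then have "integral {0..1} (\<lambda>t. norm (velocity \<gamma> (\<sigma> * t))) = integral {-1..-1 + 1} (\<lambda>t. norm (velocity \<gamma> t))"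
      using \<sigma> Henstock_Kurzweil_Integration.integral_reflect_real[of 0 "-1" "\<lambda>t. norm (velocity \<gamma> t)"] by simp
    also have "\<dots> = integral {0..0 + 1} (\<lambda>t. norm (velocity \<gamma> t))"
      by (rule integral_periodic_shift[OF v]) (simp_all add: vper)
    finally show ?thesis by simp
  qed simp
  finally have L: "L = integral {0..1} C.speed"
    by (simp add: L_def curve_length_def)
  show ?thesis
    unfolding L p_def A_def by (rule C.isoperimetric_wigner_curve[OF \<sigma>2 \<gamma>])
qed

end
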